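(* Let $p \in (1,\infty)$ and let $u \in M(\psi)$ be a critical point of $\mathcal{E}$ with obstacle constraint. Then $u \in C^2([0,1])$ and $$u''(x) < 0 \ \text{ for all } x \in (0,1), \qquad u''(0)=u''(1)=0;$$ in particular $u$ is concave. Moreover: (i) If $1 < p \le 2$, then $u \in W^{3,\infty}(0,1)$ and $u''' \in BV(0,1)$, but in general $u \notin C^3(0,1)$ (i.e. there exist obstacles $\psi$ satisfying the standing assumptions such that no critical point in $M(\psi)$ lies in $C^3(0,1)$). (ii) If $p > 2$, then $u \in W^{3,q}(0,1)$ for all $q \in \bigl[1, \tfrac{p-1}{p-2}\bigr)$, and $u \notin W^{3,\frac{p-1}{p-2}}(0,1)$.
   Context: Standing assumptions: $G \in C^\infty(\mathbb{R})$ is odd, $\dot G>0$ (dots denote derivatives of $G$), and $s\mapsto s\dot G(s)$ belongs to $L^1(\mathbb{R})$. The obstacle $\psi \in C^0([0,1])$ satisfies $\psi(0)<0$, $\psi(1)<0$, and $\psi(x_0)>0$ for some $x_0\in(0,1)$. Let $p\in(1,\infty)$, $M(\psi) := \{ v \in W^{2,p}(0,1)\cap W^{1,p}_0(0,1) : v \ge \psi \text{ on } [0,1]\}$ and $\mathcal{E}(u) := \int_0^1 |(G(u'(x)))'|^p\,dx$. For $u\in W^{2,p}(0,1)$, Euler's substitution is $w_u(x) := -p\,\dot G(u'(x))^{p-1}|u''(x)|^{p-2}u''(x)$ (a.e.), an element of $L^{p/(p-1)}(0,1)$. A function $u\in M(\psi)$ is called a critical point of $\mathcal{E}$ with obstacle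 constraint if there is a Radon measure $\mu$ supported on $\{u=\psi\}$ such that $-\int_0^1 w_u(x)\,\frac{d}{dx}\bigl(\dot G(u'(x))\phi'(x)\bigr)\,dx = \int_0^1 \phi\,d\mu$ for all $\phi \in W^{2,p}(0,1)\cap W^{1,p}_0(0,1)$. *)

theory Defs
  imports "HOL-Analysis.Analysis"
begin

(* All function spaces are over the interval (0,1) (closure [0,1]). Functions real => real;
   values outside [0,1] are irrelevant. *)

definition Lp_on :: "real \<Rightarrow> (real \<Rightarrow> real) \<Rightarrow> bool" where
  "Lp_on q f \<longleftrightarrow> f \<in> borel_measurable (lebesgue_on {0..1}) \<and>
      integrable (lebesgue_on {0..1}) (\<lambda>x. \<bar>f x\<bar> powr q)"

definition Linf_on :: "(real \<Rightarrow> real) \<Rightarrow> bool" where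
  "Linf_on f \<longleftrightarrow> f \<in> borel_measurable (lebesgue_on {0..1}) \<and>
      (\<exists>C. AE x in lebesgue_on {0..1}. \<bar>f x\<bar> \<le> C)"

text \<open>sob_chain k u D: D 0 = u on [0,1], and for j < k, D j is the indefinite (Lebesgue)
  integral of the integrable function D (j+1), i.e. D j is absolutely continuous with
  weak derivative D (j+1).  (1D characterisation of weak derivatives, continuous representative.)\<close>
definition sob_chain :: "nat \<Rightarrow> (real \<Rightarrow> real) \<Rightarrow> (nat \<Rightarrow> real \<Rightarrow> real) \<Rightarrow> bool" where
  "sob_chain k u D \<longleftrightarrow> (\<forall>x\<in>{0..1}. D 0 x = u x) \<and>
     (\<forall>j<k. integrable (lebesgue_on {0..1}) (D (Suc j)) \<and>
        (\<forall>x\<in>{0..1}. D j x = D j 0 + integral\<^sup>L (lebesgue_on {0..x}) (D (Suc j))))"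

definition sobolev :: "nat \<Rightarrow> ((real \<Rightarrow> real) \<Rightarrow> bool) \<Rightarrow> (real \<Rightarrow> real) \<Rightarrow> bool" where
  "sobolev k X u \<longleftrightarrow> (\<exists>D. sob_chain k u D \<and> (\<forall>j\<le>k. X (D j)))"

definition W0_1p :: "(real \<Rightarrow> real) \<Rightarrow> bool" where
  "W0_1p u \<longleftrightarrow> u 0 = 0 \<and> u 1 = 0"

definition M_set :: "real \<Rightarrow> (real \<Rightarrow> real) \<Rightarrow> (real \<Rightarrow> real) set" where
  "M_set p \<psi> = {v. sobolev 2 (Lp_on p) v \<and> W0_1p v \<and> (\<forall>x\<in>{0..1}. v x \<ge> \<psi> x)}"

definition energy_E :: "(real \<Rightarrow> real) \<Rightarrow> real \<Rightarrow> (real \<Rightarrow> real) \<Rightarrow> real" where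
  "energy_E G p u = integral\<^sup>L (lebesgue_on {0..1})
       (\<lambda>x. \<bar>deriv (\<lambda>y. G (deriv u y)) x\<bar> powr p)"

definition euler_w :: "(real \<Rightarrow> real) \<Rightarrow> real \<Rightarrow> (real \<Rightarrow> real) \<Rightarrow> real \<Rightarrow> real" where
  "euler_w G p u x = - p * (deriv G (deriv u x)) powr (p - 1)
       * \<bar>deriv (deriv u) x\<bar> powr (p - 2) * deriv (deriv u) x"

definition standing_G :: "(real \<Rightarrow> real) \<Rightarrow> bool" where
  "standing_G G \<longleftrightarrow> (\<forall>n x. ((deriv ^^ n) G) differentiable (at x)) \<and>
     (\<forall>x. G (- x) = - G x) \<and> (\<forall>x. deriv G x > 0) \<and>
     integrable lborel (\<lambda>s. s * deriv G s)"

definition standing_psi :: "(real \<Rightarrow> real) \<Rightarrow> bool" where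
  "standing_psi \<psi> \<longleftrightarrow> continuous_on {0..1} \<psi> \<and> \<psi> 0 < 0 \<and> \<psi> 1 < 0 \<and>
     (\<exists>x0\<in>{0<..<1}. \<psi> x0 > 0)"

definition critical_obstacle ::
  "(real \<Rightarrow> real) \<Rightarrow> real \<Rightarrow> (real \<Rightarrow> real) \<Rightarrow> (real \<Rightarrow> real) \<Rightarrow> bool" where
  "critical_obstacle G p \<psi> u \<longleftrightarrow> u \<in> M_set p \<psi> \<and>
     (\<exists>\<mu>::real measure. sets \<mu> = sets (restrict_space borel {0..1}) \<and> finite_measure \<mu> \<and>
        emeasure \<mu> ({0..1} - {x. u x = \<psi> x}) = 0 \<and>
        (\<forall>\<phi>. sobolev 2 (Lp_on p) \<phi> \<and> W0_1p \<phi> \<longrightarrow>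
           - integral\<^sup>L (lebesgue_on {0..1})
               (\<lambda>x. euler_w G p u x * deriv (\<lambda>y. deriv G (deriv u y) * deriv \<phi> y) x)
           = integral\<^sup>L \<mu> \<phi>))"

definition C2_closed_with :: "(real \<Rightarrow> real) \<Rightarrow> (real \<Rightarrow> real) \<Rightarrow> (real \<Rightarrow> real) \<Rightarrow> bool" where
  "C2_closed_with u u1 u2 \<longleftrightarrow> continuous_on {0..1} u2 \<and>
     (\<forall>x\<in>{0..1}. (u has_real_derivative u1 x) (at x within {0..1}) \<and>
                  (u1 has_real_derivative u2 x) (at x within {0..1}))"

definition C3_open :: "(real \<Rightarrow> real) \<Rightarrow> bool" where
  "C3_open u \<longleftrightarrow> (\<exists>u1 u2 u3. continuous_on {0<..<1} u3 \<and>
     (\<forall>x\<in>{0<..<1}. (u has_real_derivative u1 x) (at x) \<and>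
        (u1 has_real_derivative u2 x) (at x) \<and> (u2 has_real_derivative u3 x) (at x)))"

definition bv_open :: "(real \<Rightarrow> real) \<Rightarrow> bool" where
  "bv_open f \<longleftrightarrow> (\<exists>B. \<forall>(n::nat) t. (\<forall>i<n. t i \<le> t (Suc i)) \<and> 0 < t 0 \<and> t n < 1 \<longrightarrow>
       (\<Sum>i<n. \<bar>f (t (Suc i)) - f (t i)\<bar>) \<le> B)"

text \<open>u''' \<in> BV(0,1): some representative of the (a.e. determined) third weak derivative has
  bounded variation.\<close>
definition third_deriv_BV :: "(real \<Rightarrow> real) \<Rightarrow> bool" where
  "third_deriv_BV u \<longleftrightarrow> (\<exists>D. sob_chain 3 u D \<and> bv_open (D 3))"

end

theory Submission
  imports Defs
begin

text \<open>
  Write \<open>w\<close> for Euler's substitution and \<open>m y = \<mu> [y,1]\<close>. Testing with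
  \<open>\<phi> = \<integral> \<eta> / G'(u')\<close> turns the weak equation into
  \<open>- \<integral> w \<eta>' = \<integral> \<eta> m / G'(u')\<close> for all \<open>\<eta>\<close> with \<open>\<integral> \<eta> / G'(u') = 0\<close>. Since a constant can
  be added to \<open>\<eta>\<close>, \<open>\<eta>'\<close> is an arbitrary bounded function, and hence \<open>w = K\<close> a.e., where
  \<open>K' = (m - c) / G'(u')\<close> and \<open>K 0 = K 1 = 0\<close>. As \<open>m\<close> decreases from a positive constant near 0
  to 0 near 1, \<open>K\<close> first increases and then decreases, is positive inside and vanishes linearly at
  both ends. Solving \<open>w = K\<close> for the second derivative gives
  \<open>u'' = - (K/p) powr (1/(p-1)) / G'(u')\<close>, from which all regularity claims are read off. For the
  tent obstacle the contact set is a single point, at which \<open>m\<close> jumps and \<open>K\<close> has a kink.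
\<close>

section \<open>Indefinite Lebesgue integrals\<close>

text \<open>The threshold p = 2 and the critical exponent come from a single factor. With \<alpha> =
  1/(p-1), differentiating u'' produces (K/p) to the power \<alpha> - 1, which is nonnegative
  exactly for p <= 2. For p > 2 this factor is comparable near the ends to the distance to the power
  \<alpha> - 1, whose q-th power is integrable precisely for q < (p-1)/(p-2). The sign of K rests on
  two facts about the obstacle: it is negative at the ends, so \<mu> has no mass nearby, and it is
  positive somewhere, so \<mu> cannot vanish, since otherwise u = 0. What shapes the preparations is
  the weak regularity: u'' is only in L^p, while the weak equation is written with the pointwise
  \<open>deriv\<close>. Hence product rule, chain rule and almost everywhere differentiation are
  needed for absolutely continuous functions. \<open>primitive_on\<close> records increments over
  all subintervals rather than values from a base point, so it restricts to subintervals and ignores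
  additive constants.\<close>

definition primitive_on :: "real \<Rightarrow> real \<Rightarrow> (real \<Rightarrow> real) \<Rightarrow> (real \<Rightarrow> real) \<Rightarrow> bool" where
  "primitive_on a b F f \<longleftrightarrow> f absolutely_integrable_on {a..b} \<and>
     (\<forall>s t. a \<le> s \<and> s \<le> t \<and> t \<le> b \<longrightarrow> F t - F s = integral {s..t} f)"

lemma abs_integrable_subinterval:
  fixes f :: "real \<Rightarrow> real"
  assumes "f absolutely_integrable_on {a..b}" "a \<le> s" "t \<le> b"
  shows "f absolutely_integrable_on {s..t}"
  by (rule set_integrable_subset[OF assms(1)]) (use assms in auto)

lemma abs_integrable_continuous:
  fixes f :: "real \<Rightarrow> real"
  assumes "continuous_on {a..b} f"
  shows "f absolutely_integrable_on {a..b}"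
  using absolutely_integrable_continuous[of a b f] assms by simp

lemma abs_integrable_lebesgue_on:
  fixes f :: "real \<Rightarrow> real"
  shows "f absolutely_integrable_on {a..b} \<longleftrightarrow> integrable (lebesgue_on {a..b}) f"
  by (simp add: integrable_restrict_space set_integrable_def)

lemma integral_abs_bound:
  fixes f :: "real \<Rightarrow> real"
  assumes "f absolutely_integrable_on {s..t}"
  shows "\<bar>integral {s..t} f\<bar> \<le> integral {s..t} (\<lambda>x. \<bar>f x\<bar>)"
  using integral_norm_bound_integral[of f "{s..t}" "\<lambda>x. \<bar>f x\<bar>"] assms
  by (auto simp: absolutely_integrable_on_def)

lemma primitive_onD:
  assumes "primitive_on a b F f"
  shows "f absolutely_integrable_on {a..b}"
    and "a \<le> s \<Longrightarrow> s \<le> t \<Longrightarrow> t \<le> b \<Longrightarrow> F t - F s = integral {s..t} f"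
  using assms unfolding primitive_on_def by auto

lemma primitive_on_subinterval:
  assumes "primitive_on a b F f" "a \<le> s" "t \<le> b"
  shows "primitive_on s t F f"
  using assms unfolding primitive_on_def
  by (auto intro: abs_integrable_subinterval[where a=a and b=b])

lemma primitive_on_from_left:
  fixes f :: "real \<Rightarrow> real"
  assumes f: "f absolutely_integrable_on {a..b}"
    and F: "\<And>x. a \<le> x \<Longrightarrow> x \<le> b \<Longrightarrow> F x = c + integral {a..x} f"
  shows "primitive_on a b F f"
  unfolding primitive_on_def
proof (intro conjI f allI impI)
  fix s t assume st: "a \<le> s \<and> s \<le> t \<and> t \<le> b"
  have "f absolutely_integrable_on {a..t}" using abs_integrable_subinterval[OF f] st by auto
  then have "f integrable_on {a..t}" by (simp add: absolutely_integrable_on_def)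
  then have "integral {a..s} f + integral {s..t} f = integral {a..t} f"
    using st by (intro Henstock_Kurzweil_Integration.integral_combine) auto
  then show "F t - F s = integral {s..t} f" using F[of s] F[of t] st by auto
qed

lemma primitive_on_integral:
  fixes f :: "real \<Rightarrow> real"
  assumes f: "f absolutely_integrable_on {a..b}"
  shows "primitive_on a b (\<lambda>x. integral {a..x} f) f"
  by (rule primitive_on_from_left[OF f, where c=0]) auto

lemma primitive_on_cong:
  assumes "primitive_on a b F f" "\<And>x. a \<le> x \<Longrightarrow> x \<le> b \<Longrightarrow> F' x = F x"
  shows "primitive_on a b F' f"
  using assms unfolding primitive_on_def by auto

lemma primitive_on_continuous:
  assumes "primitive_on a b F f"
  shows "continuous_on {a..b} F"
proof -
  have "f integrable_on {a..b}"
    using assms by (auto simp: primitive_on_def absolutely_integrable_on_def)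
  then have "continuous_on {a..b} (\<lambda>x. F a + integral {a..x} f)"
    by (intro continuous_intros indefinite_integral_continuous_1)
  then show ?thesis
  proof (rule continuous_on_eq)
    fix x assume "x \<in> {a..b}"
    then show "F a + integral {a..x} f = F x" using primitive_onD(2)[OF assms, of a x] by auto
  qed
qed

text \<open>A density counts only up to null sets. This is how the representative \<open>v\<close>
  of the second derivative is later traded for a continuous function.\<close>

lemma primitive_on_AE:
  assumes F: "primitive_on a b F f" and g: "AE x in lebesgue_on {a..b}. f x = g x"
    and gm: "g \<in> borel_measurable (lebesgue_on {a..b})"
  shows "primitive_on a b F g"
proof -
  have f: "integrable (lebesgue_on {a..b}) f"
    using primitive_onD(1)[OF F] by (simp add: abs_integrable_lebesgue_on)
  have "integrable (lebesgue_on {a..b}) g"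
    using integrable_cong_AE_imp[OF f gm] g by (simp add: eq_commute)
  then have gi: "g absolutely_integrable_on {a..b}"
    by (simp add: abs_integrable_lebesgue_on)
  have "integral {s..t} f = integral {s..t} g" if "a \<le> s" "t \<le> b" for s t
  proof -
    obtain N where N: "N \<in> null_sets lebesgue" "{x\<in>{a..b}. f x \<noteq> g x} \<subseteq> N"
      using g[unfolded AE_restrict_space_iff[of "{a..b}" lebesgue, simplified]]
      by (auto simp: eventually_ae_filter)
    show ?thesis
    proof (rule integral_spike[of N])
      show "g x = f x" if "x \<in> {s..t} - N" for x
    proof -
      have "x \<in> {a..b}" "x \<notin> N" using that \<open>a \<le> s\<close> \<open>t \<le> b\<close> by auto
      then show ?thesis using N(2) by (metis (mono_tags, lifting) mem_Collect_eq subsetD)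
    qed
    qed (use N in \<open>simp add: negligible_iff_null_sets\<close>)
  qed
  then show ?thesis using F gi unfolding primitive_on_def by auto
qed

text \<open>Chopping \<open>{a..b}\<close> into N equal pieces shorter than \<open>d\<close> makes
  the bounds telescope to \<open>e * (V b - V a)\<close>, and \<open>e\<close> is arbitrary. Small
  increments replace a derivative that exists only almost everywhere.\<close>

lemma small_increments_imp_const:
  fixes \<Phi> V :: "real \<Rightarrow> real"
  assumes ab: "a \<le> b"
    and small: "\<And>e. e > 0 \<Longrightarrow> \<exists>d>0. \<forall>s t. a \<le> s \<and> s \<le> t \<and> t \<le> b \<and> t - s < d \<longrightarrow>
            \<bar>\<Phi> t - \<Phi> s\<bar> \<le> e * (V t - V s)"
  shows "\<Phi> b = \<Phi> a"
proof -
  have main: "\<bar>\<Phi> b - \<Phi> a\<bar> \<le> e * (V b - V a)" if "e > 0" for e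
  proof -
    obtain d where d: "d > 0" "\<And>s t. a \<le> s \<Longrightarrow> s \<le> t \<Longrightarrow> t \<le> b \<Longrightarrow> t - s < d \<Longrightarrow>
         \<bar>\<Phi> t - \<Phi> s\<bar> \<le> e * (V t - V s)" using small[OF \<open>e > 0\<close>] by blast
    obtain N :: nat where N: "(b - a) / d < real N" using reals_Archimedean2 by blast
    have N0: "real N > 0" using N ab d(1) by (meson divide_nonneg_pos diff_ge_0_iff_ge order_le_less_trans)
    define h where "h = (b - a) / N"
    have h: "0 \<le> h" "h < d" "real N * h = b - a"
      using N N0 ab d(1) by (auto simp: h_def field_simps)
    have "i \<le> N \<Longrightarrow> \<bar>\<Phi> (a + real i * h) - \<Phi> a\<bar> \<le> e * (V (a + real i * h) - V a)" for i
    proof (induction i)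
      case (Suc i)
      let ?s = "a + real i * h" let ?t = "a + real (Suc i) * h"
      have "real (Suc i) * h \<le> real N * h"
        using Suc.prems h(1) by (intro mult_right_mono) auto
      then have "?t \<le> b" using h by simp
      moreover have "a \<le> ?s" "?s \<le> ?t" "?t - ?s < d" using h by (auto simp: algebra_simps)
      ultimately have "\<bar>\<Phi> ?t - \<Phi> ?s\<bar> \<le> e * (V ?t - V ?s)" by (intro d)
      then show ?case using Suc by (simp add: algebra_simps)
    qed simp
    from this[of N] h show ?thesis by (simp add: algebra_simps)
  qed
  have "\<bar>\<Phi> b - \<Phi> a\<bar> \<le> 0 + e" if "e > 0" for e
  proof -
    \<comment> \<open>The added 1 keeps the divisor positive even if
      \<open>V b = V a\<close>.\<close>
    let ?v = "\<bar>V b - V a\<bar> + 1"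
    have "\<bar>\<Phi> b - \<Phi> a\<bar> \<le> (e / ?v) * (V b - V a)" using that by (intro main) auto
    also have "\<dots> \<le> (e / ?v) * ?v" using that by (intro mult_left_mono) auto
    finally show ?thesis by simp
  qed
  then have "\<bar>\<Phi> b - \<Phi> a\<bar> \<le> 0" by (rule field_le_epsilon)
  then show ?thesis by simp
qed

text \<open>With \<open>V\<close> the indefinite integral of \<open>v\<close>, the defect
  \<open>H x - integral {a..x} h\<close> has small increments and is constant. The chain and the
  product rule both reduce to this local error estimate.\<close>

lemma primitive_on_local_criterion:
  fixes H h v :: "real \<Rightarrow> real"
  assumes h: "h absolutely_integrable_on {a..b}" and v: "v absolutely_integrable_on {a..b}"
    and small: "\<And>e. e > 0 \<Longrightarrow> \<exists>d>0. \<forall>s t. a \<le> s \<and> s \<le> t \<and> t \<le> b \<and> t - s < d \<longrightarrow>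
            \<bar>H t - H s - integral {s..t} h\<bar> \<le> e * integral {s..t} v"
  shows "primitive_on a b H h"
  unfolding primitive_on_def
proof (intro conjI h allI impI)
  fix s t assume st: "a \<le> s \<and> s \<le> t \<and> t \<le> b"
  let ?P = "\<lambda>x. H x - integral {a..x} h"
  have hp: "integral {a..y} h - integral {a..x} h = integral {x..y} h"
    and vp: "integral {a..y} v - integral {a..x} v = integral {x..y} v"
    if "a \<le> x" "x \<le> y" "y \<le> b" for x y
    by (rule primitive_onD(2)[OF primitive_on_integral[OF h] that]
      primitive_onD(2)[OF primitive_on_integral[OF v] that])+
  have "?P t = ?P s"
  proof (rule small_increments_imp_const[where \<Phi> = ?P and V = "\<lambda>x. integral {a..x} v"])
    fix e :: real assume "e > 0"
    obtain d where d: "d > 0" "\<And>s t. a \<le> s \<Longrightarrow> s \<le> t \<Longrightarrow> t \<le> b \<Longrightarrow> t - s < d \<Longrightarrow>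
            \<bar>H t - H s - integral {s..t} h\<bar> \<le> e * integral {s..t} v" using small[OF \<open>e > 0\<close>] by metis
    show "\<exists>d>0. \<forall>x y. s \<le> x \<and> x \<le> y \<and> y \<le> t \<and> y - x < d \<longrightarrow>
            \<bar>?P y - ?P x\<bar> \<le> e * (integral {a..y} v - integral {a..x} v)"
    proof (intro exI[of _ d] conjI d allI impI)
      fix x y assume xy: "s \<le> x \<and> x \<le> y \<and> y \<le> t \<and> y - x < d"
      then have "\<bar>H y - H x - integral {x..y} h\<bar> \<le> e * integral {x..y} v" using st by (intro d) auto
      then show "\<bar>?P y - ?P x\<bar> \<le> e * (integral {a..y} v - integral {a..x} v)"
        using hp[of x y] vp[of x y] xy st by (simp add: algebra_simps)
    qed
  qed (use st in auto)
  then show "H t - H s = integral {s..t} h" using hp[of s t] st by auto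
qed

lemma abs_integrable_mult_continuous:
  fixes f g :: "real \<Rightarrow> real"
  assumes f: "f absolutely_integrable_on {a..b}" and g: "continuous_on {a..b} g"
  shows "(\<lambda>x. g x * f x) absolutely_integrable_on {a..b}"
proof (rule absolutely_integrable_bounded_measurable_product_real)
  show "g \<in> borel_measurable (lebesgue_on {a..b})"
    using g by (intro continuous_imp_measurable_on_sets_lebesgue) auto
  show "bounded (g ` {a..b})"
    by (intro compact_imp_bounded compact_continuous_image g) auto
qed (use f in auto)

lemma integral_mult_abs_bound:
  fixes f g :: "real \<Rightarrow> real"
  assumes f: "f absolutely_integrable_on {s..t}" and g: "continuous_on {s..t} g"
    and e: "\<And>x. s \<le> x \<Longrightarrow> x \<le> t \<Longrightarrow> \<bar>g x\<bar> \<le> e"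
  shows "\<bar>integral {s..t} (\<lambda>x. g x * f x)\<bar> \<le> e * integral {s..t} (\<lambda>x. \<bar>f x\<bar>)"
proof -
  have "norm (integral {s..t} (\<lambda>x. g x * f x)) \<le> integral {s..t} (\<lambda>x. e * \<bar>f x\<bar>)"
  proof (rule integral_norm_bound_integral)
    show "(\<lambda>x. g x * f x) integrable_on {s..t}"
      using abs_integrable_mult_continuous[OF f g] by (simp add: absolutely_integrable_on_def)
    show "(\<lambda>x. e * \<bar>f x\<bar>) integrable_on {s..t}"
      using f by (auto simp: absolutely_integrable_on_def intro!: integrable_on_mult_right)
    show "norm (g x * f x) \<le> e * \<bar>f x\<bar>" if "x \<in> {s..t}" for x
      using e[of x] that by (auto simp: abs_mult intro!: mult_right_mono)
  qed
  then show ?thesis by simp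
qed

text \<open>On a short interval the mean value theorem writes the increment of \<open>H\<close> as
  \<open>H' (F r)\<close> times the increment of \<open>F\<close>; the error is the integral of
  \<open>(H' (F r) - H' (F x)) * f x\<close>, small by uniform continuity of
  \<open>H' \<circ> F\<close>.\<close>

lemma primitive_on_chain:
  fixes H H' :: "real \<Rightarrow> real"
  assumes F: "primitive_on a b F f"
    and H: "\<And>y. y \<in> F ` {a..b} \<Longrightarrow> (H has_real_derivative H' y) (at y)"
    and H': "continuous_on (F ` {a..b}) H'"
  shows "primitive_on a b (\<lambda>x. H (F x)) (\<lambda>x. H' (F x) * f x)"
proof -
  have cF: "continuous_on {a..b} F" by (rule primitive_on_continuous[OF F])
  have cHF: "continuous_on {a..b} (\<lambda>x. H' (F x))"
    using continuous_on_compose2[OF H' cF] by auto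
  have f: "f absolutely_integrable_on {a..b}" by (rule primitive_onD[OF F])
  show ?thesis
  proof (rule primitive_on_local_criterion[where v = "\<lambda>x. \<bar>f x\<bar>"])
    show "(\<lambda>x. H' (F x) * f x) absolutely_integrable_on {a..b}"
      by (rule abs_integrable_mult_continuous[OF f cHF])
    show "(\<lambda>x. \<bar>f x\<bar>) absolutely_integrable_on {a..b}"
      using f by (rule set_integrable_abs)
    fix e :: real assume e: "e > 0"
    have "uniformly_continuous_on {a..b} (\<lambda>x. H' (F x))"
      by (intro compact_uniformly_continuous cHF) auto
    then obtain d where d: "d > 0" "\<And>x y. x \<in> {a..b} \<Longrightarrow> y \<in> {a..b} \<Longrightarrow> dist y x < d \<Longrightarrow>
        dist (H' (F y)) (H' (F x)) < e"
      using e unfolding uniformly_continuous_on_def by metis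
    show "\<exists>d>0. \<forall>s t. a \<le> s \<and> s \<le> t \<and> t \<le> b \<and> t - s < d \<longrightarrow>
       \<bar>H (F t) - H (F s) - integral {s..t} (\<lambda>x. H' (F x) * f x)\<bar> \<le> e * integral {s..t} (\<lambda>x. \<bar>f x\<bar>)"
    proof (intro exI[of _ d] conjI d allI impI)
      fix s t assume st: "a \<le> s \<and> s \<le> t \<and> t \<le> b \<and> t - s < d"
      have cst: "continuous_on {s..t} F" by (rule continuous_on_subset[OF cF]) (use st in auto)
      \<comment> \<open>The mean value point is a number between \<open>F s\<close> and
        \<open>F t\<close>; connectedness of the image makes it a value \<open>F r\<close> with
        \<open>r\<close> in \<open>{s..t}\<close>, where uniform continuity applies.\<close>
      have "connected (F ` {s..t})" by (intro connected_continuous_image cst) auto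
      then have seg: "closed_segment (F s) (F t) \<subseteq> F ` {s..t}"
        using st by (intro closed_segment_subset) (auto simp: is_interval_connected_1[symmetric] is_interval_convex_1[symmetric])
      have "\<exists>\<xi>. \<xi> \<in> closed_segment (F s) (F t) \<and> H (F t) - H (F s) = H' \<xi> * (F t - F s)"
      proof (cases "F s = F t")
        case False
        have D: "(H has_real_derivative H' y) (at y)" if "y \<in> closed_segment (F s) (F t)" for y
          using seg that st by (intro H) auto
        show ?thesis
        proof (cases "F s < F t")
          case True
          then obtain z where "F s < z" "z < F t" "H (F t) - H (F s) = (F t - F s) * H' z"
            using MVT2[of "F s" "F t" H H'] D by (auto simp: closed_segment_eq_real_ivl)
          then show ?thesis by (intro exI[of _ z]) (auto simp: closed_segment_eq_real_ivl)
        next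
          case F2: False
          then obtain z where "F t < z" "z < F s" "H (F s) - H (F t) = (F s - F t) * H' z"
            using MVT2[of "F t" "F s" H H'] D False by (auto simp: closed_segment_eq_real_ivl)
          then show ?thesis by (intro exI[of _ z]) (auto simp: closed_segment_eq_real_ivl algebra_simps)
        qed
      qed auto
      then obtain r where r: "r \<in> {s..t}" "H (F t) - H (F s) = H' (F r) * (F t - F s)"
        using seg by blast
      have fst: "f absolutely_integrable_on {s..t}" using abs_integrable_subinterval[OF f] st by auto
      have cHst: "continuous_on {s..t} (\<lambda>x. H' (F x))"
        by (rule continuous_on_subset[OF cHF]) (use st in auto)
      have "H (F t) - H (F s) - integral {s..t} (\<lambda>x. H' (F x) * f x)
          = integral {s..t} (\<lambda>x. H' (F r) * f x) - integral {s..t} (\<lambda>x. H' (F x) * f x)"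
        using r primitive_onD(2)[OF F, of s t] st by simp
      also have "\<dots> = integral {s..t} (\<lambda>x. (H' (F r) - H' (F x)) * f x)"
        using fst abs_integrable_mult_continuous[OF fst cHst]
        by (subst Henstock_Kurzweil_Integration.integral_diff[symmetric])
          (auto simp: absolutely_integrable_on_def left_diff_distrib intro!: integrable_on_mult_right)
      finally have eq: "H (F t) - H (F s) - integral {s..t} (\<lambda>x. H' (F x) * f x)
          = integral {s..t} (\<lambda>x. (H' (F r) - H' (F x)) * f x)" .
      show "\<bar>H (F t) - H (F s) - integral {s..t} (\<lambda>x. H' (F x) * f x)\<bar> \<le> e * integral {s..t} (\<lambda>x. \<bar>f x\<bar>)"
        unfolding eq
      proof (rule integral_mult_abs_bound[OF fst])
        fix x assume "s \<le> x" "x \<le> t"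
        moreover from this have "\<bar>r - x\<bar> < d" using r(1) st by auto
        ultimately show "\<bar>H' (F r) - H' (F x)\<bar> \<le> e"
          using d(2)[of x r] r(1) st by (auto simp: dist_real_def)
      qed (intro continuous_intros cHst)
    qed
  qed
qed

text \<open>The increment of the product is \<open>(F t - F s) * G t + F s * (G t - G s)\<close>;
  freezing the factors at end points costs only their oscillation over a short interval.\<close>

lemma primitive_on_mult:
  assumes F: "primitive_on a b F f" and G: "primitive_on a b G g"
  shows "primitive_on a b (\<lambda>x. F x * G x) (\<lambda>x. G x * f x + F x * g x)"
proof -
  have cF: "continuous_on {a..b} F" and cG: "continuous_on {a..b} G"
    using primitive_on_continuous F G by auto
  have f: "f absolutely_integrable_on {a..b}" and g: "g absolutely_integrable_on {a..b}"
    using primitive_onD F G by auto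
  show ?thesis
  proof (rule primitive_on_local_criterion[where v = "\<lambda>x. \<bar>f x\<bar> + \<bar>g x\<bar>"])
    show "(\<lambda>x. G x * f x + F x * g x) absolutely_integrable_on {a..b}"
      by (intro set_integral_add abs_integrable_mult_continuous f g cF cG)
    show "(\<lambda>x. \<bar>f x\<bar> + \<bar>g x\<bar>) absolutely_integrable_on {a..b}"
      by (intro set_integral_add set_integrable_abs f g)
    fix e :: real assume e: "e > 0"
    have "uniformly_continuous_on {a..b} F" "uniformly_continuous_on {a..b} G"
      by (intro compact_uniformly_continuous cF cG; simp)+
    then obtain d1 d2 where d1: "d1 > 0" "\<And>x y. x \<in> {a..b} \<Longrightarrow> y \<in> {a..b} \<Longrightarrow> dist y x < d1 \<Longrightarrow>
        dist (F y) (F x) < e"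
      and d2: "d2 > 0" "\<And>x y. x \<in> {a..b} \<Longrightarrow> y \<in> {a..b} \<Longrightarrow> dist y x < d2 \<Longrightarrow>
        dist (G y) (G x) < e"
      using e unfolding uniformly_continuous_on_def by metis
    show "\<exists>d>0. \<forall>s t. a \<le> s \<and> s \<le> t \<and> t \<le> b \<and> t - s < d \<longrightarrow>
       \<bar>F t * G t - F s * G s - integral {s..t} (\<lambda>x. G x * f x + F x * g x)\<bar>
         \<le> e * integral {s..t} (\<lambda>x. \<bar>f x\<bar> + \<bar>g x\<bar>)"
    proof (intro exI[of _ "min d1 d2"] conjI allI impI)
      fix s t assume st: "a \<le> s \<and> s \<le> t \<and> t \<le> b \<and> t - s < min d1 d2"
      have fst: "f absolutely_integrable_on {s..t}" and gst: "g absolutely_integrable_on {s..t}"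
        using abs_integrable_subinterval[OF f] abs_integrable_subinterval[OF g] st by auto
      have cs: "continuous_on {s..t} F" "continuous_on {s..t} G"
        using st by (auto intro!: continuous_on_subset[OF cF] continuous_on_subset[OF cG])
      note int = fst[unfolded absolutely_integrable_on_def] gst[unfolded absolutely_integrable_on_def]
        abs_integrable_mult_continuous[OF fst cs(2), unfolded absolutely_integrable_on_def]
        abs_integrable_mult_continuous[OF gst cs(1), unfolded absolutely_integrable_on_def]
      have "F t * G t - F s * G s = (F t - F s) * G t + F s * (G t - G s)" by (simp add: algebra_simps)
      also have "\<dots> = integral {s..t} (\<lambda>x. G t * f x) + integral {s..t} (\<lambda>x. F s * g x)"
        using primitive_onD(2)[OF F, of s t] primitive_onD(2)[OF G, of s t] st by simp
      finally have "F t * G t - F s * G s - integral {s..t} (\<lambda>x. G x * f x + F x * g x)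
         = (integral {s..t} (\<lambda>x. G t * f x) - integral {s..t} (\<lambda>x. G x * f x)) + (integral {s..t} (\<lambda>x. F s * g x)
           - integral {s..t} (\<lambda>x. F x * g x))"
        using int by (subst Henstock_Kurzweil_Integration.integral_add) auto
      also have "\<dots> = integral {s..t} (\<lambda>x. (G t - G x) * f x) + integral {s..t} (\<lambda>x. (F s - F x) * g x)"
        using int by (subst (1 2) Henstock_Kurzweil_Integration.integral_diff[symmetric])
           (auto simp: left_diff_distrib intro!: integrable_on_mult_right)
      finally have eq: "F t * G t - F s * G s - integral {s..t} (\<lambda>x. G x * f x + F x * g x) = \<dots>" .
      have "\<bar>integral {s..t} (\<lambda>x. (G t - G x) * f x)\<bar> \<le> e * integral {s..t} (\<lambda>x. \<bar>f x\<bar>)"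
      proof (rule integral_mult_abs_bound[OF fst])
        fix x assume "s \<le> x" "x \<le> t"
        then show "\<bar>G t - G x\<bar> \<le> e"
          using d2(2)[of x t] st by (auto simp: dist_real_def)
      qed (intro continuous_intros cs)
      moreover have "\<bar>integral {s..t} (\<lambda>x. (F s - F x) * g x)\<bar> \<le> e * integral {s..t} (\<lambda>x. \<bar>g x\<bar>)"
      proof (rule integral_mult_abs_bound[OF gst])
        fix x assume "s \<le> x" "x \<le> t"
        then show "\<bar>F s - F x\<bar> \<le> e"
          using d1(2)[of x s] st by (auto simp: dist_real_def)
      qed (intro continuous_intros cs)
      moreover have "integral {s..t} (\<lambda>x. \<bar>f x\<bar> + \<bar>g x\<bar>) = integral {s..t} (\<lambda>x. \<bar>f x\<bar>) + integral {s..t} (\<lambda>x. \<bar>g x\<bar>)"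
        using int by (intro Henstock_Kurzweil_Integration.integral_add) auto
      ultimately show "\<bar>F t * G t - F s * G s - integral {s..t} (\<lambda>x. G x * f x + F x * g x)\<bar>
         \<le> e * integral {s..t} (\<lambda>x. \<bar>f x\<bar> + \<bar>g x\<bar>)"
        unfolding eq by (simp add: algebra_simps)
    qed (use d1 d2 in auto)
  qed
qed

text \<open>Meant for formulas that degenerate at the ends: the identity is checked on compact
  subintervals only, and continuity of \<open>F\<close> together with integrability of
  \<open>f\<close> extends it.\<close>

lemma primitive_on_open:
  fixes F f :: "real \<Rightarrow> real"
  assumes ab: "a < b" and f: "f absolutely_integrable_on {a..b}" and cF: "continuous_on {a..b} F"
    and open_eq: "\<And>s t. a < s \<Longrightarrow> s \<le> t \<Longrightarrow> t < b \<Longrightarrow> F t - F s = integral {s..t} f"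
  shows "primitive_on a b F f"
proof -
  define P where "P x = integral {a..x} f" for x
  have P: "primitive_on a b P f" unfolding P_def by (rule primitive_on_integral[OF f])
  note cP = primitive_on_continuous[OF P]
  have "F x - P x = F ((a+b)/2) - P ((a+b)/2)" if "x \<in> {a<..<b}" for x
    using open_eq[of x "(a+b)/2"] open_eq[of "(a+b)/2" x]
      primitive_onD(2)[OF P, of x "(a+b)/2"] primitive_onD(2)[OF P, of "(a+b)/2" x] that
    by (cases "x \<le> (a+b)/2") auto
  then obtain c where eq: "\<And>x. x \<in> {a<..<b} \<Longrightarrow> F x - P x = c" by blast
  have "F x - P x = c" if "x \<in> {a..b}" for x
  proof (rule continuous_constant_on_closure[of "{a<..<b}" "\<lambda>x. F x - P x"])
    show "continuous_on (closure {a<..<b}) (\<lambda>x. F x - P x)"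
      using ab by (auto intro!: continuous_intros cF cP)
    show "x \<in> closure {a<..<b}" using ab that by simp
  qed (rule eq)
  then have "F x = c + integral {a..x} f" if "x \<in> {a..b}" for x
    using that by (simp add: P_def diff_eq_eq)
  then show ?thesis
    by (intro primitive_on_from_left[OF f, where c = c]) simp
qed

text \<open>Lebesgue differentiation in the form \<open>integrable_ccontinuous_explicit\<close>
  controls intervals to the right of a point; applying it also to the reflection \<open>fm\<close>
  controls those to the left.\<close>

lemma primitive_on_AE_derivative:
  assumes F: "primitive_on a b F f"
  shows "AE x in lebesgue_on {a..b}. (F has_real_derivative f x) (at x)"
proof (cases "a < b")
  case True
  \<comment> \<open>Extension by zero, because integrability on every box is required.\<close>
  define f0 where "f0 x = (if x \<in> {a..b} then f x else 0)" for x
  define fm where "fm x = f0 (- x)" for x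
  have f: "f integrable_on {a..b}" using primitive_onD(1)[OF F] by (simp add: absolutely_integrable_on_def)
  then have "f0 integrable_on UNIV" unfolding f0_def by (subst integrable_restrict_UNIV)
  then have f0: "f0 integrable_on cbox c d" for c d
    using integrable_on_subcbox by blast
  have fm: "fm integrable_on cbox c d" for c d
    using f0[of "-d" "-c"] Henstock_Kurzweil_Integration.integrable_reflect_real[where f = f0 and a = "-d" and b = "-c"] unfolding fm_def[abs_def] by simp
  obtain N1 where N1: "negligible N1" "\<And>x e. x \<notin> N1 \<Longrightarrow> 0 < e \<Longrightarrow>
       \<exists>d>0. \<forall>h. 0 < h \<and> h < d \<longrightarrow> \<bar>integral {x..x+h} f0 / h - f0 x\<bar> < e"
    using integrable_ccontinuous_explicit[of f0, OF f0] by (auto simp: divide_inverse mult.commute)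
  obtain N2 where N2: "negligible N2" "\<And>x e. x \<notin> N2 \<Longrightarrow> 0 < e \<Longrightarrow>
       \<exists>d>0. \<forall>h. 0 < h \<and> h < d \<longrightarrow> \<bar>integral {x..x+h} fm / h - fm x\<bar> < e"
    using integrable_ccontinuous_explicit[of fm, OF fm] by (auto simp: divide_inverse mult.commute)
  \<comment> \<open>The end points are discarded as well, since \<open>F\<close> is unrestricted
    outside \<open>{a..b}\<close>.\<close>
  define N where "N = N1 \<union> uminus ` N2 \<union> {a,b}"
  have "negligible (uminus ` N2)"
    by (rule negligible_differentiable_image_negligible[OF _ N2(1)])
      (auto simp: differentiable_on_def)
  then have N: "negligible N" unfolding N_def using N1 by (auto intro!: negligible_Un)
  have D: "(F has_real_derivative f x) (at x)" if x: "x \<in> {a..b}" "x \<notin> N" for x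
  proof -
    have xi: "a < x" "x < b" using x by (auto simp: N_def)
    have ints: "integral {s..t} f0 = integral {s..t} f" if "a \<le> s" "t \<le> b" for s t
      by (rule Henstock_Kurzweil_Integration.integral_cong) (use that in \<open>auto simp: f0_def\<close>)
    have refl: "integral {-x..-x+h} fm = integral {x-h..x} f0" for h
      using Henstock_Kurzweil_Integration.integral_reflect_real[of "x" "x - h" f0] by (simp add: fm_def[abs_def] algebra_simps)
    have "((\<lambda>h. (F (x + h) - F x) / h) \<longlongrightarrow> f x) (at 0)"
    proof (rule tendstoI)
      fix e :: real assume e: "e > 0"
      have "x \<notin> N1" "- x \<notin> N2" using x by (auto simp: N_def image_iff)
      then obtain d1 d2 where d1: "d1 > 0" "\<And>h. 0 < h \<Longrightarrow> h < d1 \<Longrightarrow> \<bar>integral {x..x+h} f0 / h - f0 x\<bar> < e"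
        and d2: "d2 > 0" "\<And>h. 0 < h \<Longrightarrow> h < d2 \<Longrightarrow> \<bar>integral {-x..-x+h} fm / h - fm (-x)\<bar> < e"
        using N1(2)[of x e] N2(2)[of "-x" e] e by metis
      define d where "d = Min {d1, d2, x - a, b - x}"
      have d: "d > 0" "d \<le> d1" "d \<le> d2" "d \<le> x - a" "d \<le> b - x"
        using d1 d2 xi by (auto simp: d_def)
      have "dist ((F (x + h) - F x) / h) (f x) < e" if h: "h \<noteq> 0" "dist h 0 < d" for h
      proof (cases "h > 0")
        case True
        then have "F (x + h) - F x = integral {x..x+h} f0"
          using primitive_onD(2)[OF F, of x "x+h"] ints[of x "x+h"] xi h d by auto
        then show ?thesis using d1(2)[of h] True h d x by (auto simp: dist_real_def f0_def)
      next
        case False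
        then have hn: "h < 0" using h by auto
        have "F x - F (x + h) = integral {x+h..x} f0"
          using primitive_onD(2)[OF F, of "x+h" x] ints[of "x+h" x] xi h d hn by (auto simp: dist_real_def)
        then have "(F (x + h) - F x) / h = integral {-x..-x+(-h)} fm / (-h)"
          using refl[of "-h"] hn by (simp add: field_simps)
        then show ?thesis using d2(2)[of "-h"] hn h d x by (auto simp: dist_real_def f0_def fm_def)
      qed
      then show "eventually (\<lambda>h. dist ((F (x + h) - F x) / h) (f x) < e) (at 0)"
        using d(1) by (auto simp: eventually_at)
    qed
    then show ?thesis by (simp add: DERIV_def)
  qed
  show ?thesis
    unfolding AE_restrict_space_iff[of "{a..b}" lebesgue, simplified]
    by (rule AE_I'[of N]) (use N D in \<open>auto simp: negligible_iff_null_sets\<close>)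
next
  case False
  then have "{a..b} \<subseteq> {a}" by auto
  then show ?thesis
    by (subst AE_restrict_space_iff, simp, intro AE_I'[of "{a}"]) auto
qed

lemma primitive_on_derivative_within:
  assumes F: "primitive_on a b F f" and f: "continuous_on {a..b} f" and x: "x \<in> {a..b}"
  shows "(F has_real_derivative f x) (at x within {a..b})"
proof -
  have "((\<lambda>t. F a + integral {a..t} f) has_real_derivative f x) (at x within {a..b})"
    by (auto intro!: derivative_eq_intros integral_has_real_derivative f x)
  then show ?thesis
  proof (rule has_field_derivative_transform_within[OF _ zero_less_one x])
    fix t assume "t \<in> {a..b}"
    then show "F a + integral {a..t} f = F t" using primitive_onD(2)[OF F, of a t] by auto
  qed
qed

lemma primitive_on_derivative:
  assumes F: "primitive_on a b F f" and f: "continuous_on {a..b} f" and x: "a < x" "x < b"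
  shows "(F has_real_derivative f x) (at x)"
  using primitive_on_derivative_within[OF F f, of x] x
  by (simp add: at_within_Icc_at)

lemma primitive_on_mvt:
  assumes F: "primitive_on a b F f" and f: "continuous_on {a..b} f" and st: "a \<le> s" "s < t" "t \<le> b"
  obtains z where "s < z" "z < t" "F t - F s = (t - s) * f z"
proof -
  have D: "(F has_real_derivative f x) (at x)" if "s < x" "x < t" for x
    using that st by (intro primitive_on_derivative[OF F f]) auto
  have c: "continuous_on {s..t} F"
    by (rule continuous_on_subset[OF primitive_on_continuous[OF F]]) (use st in auto)
  obtain z where z: "s < z" "z < t" "F t - F s = f z * (t - s)"
    using mvt[OF st(2) c, of "\<lambda>x. (*) (f x)"] D by (metis has_field_derivative_def)
  then show ?thesis using that[of z] by (simp add: mult.commute)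
qed

text \<open>For absolutely integrable densities the Bochner and gauge integrals agree, and the
  integrals from 0 determine those over all subintervals.\<close>

lemma sob_chain_iff:
  "sob_chain k u D \<longleftrightarrow> (\<forall>x\<in>{0..1}. D 0 x = u x) \<and> (\<forall>j<k. primitive_on 0 1 (D j) (D (Suc j)))"
proof -
  have "(integrable (lebesgue_on {0..1}) f \<and>
        (\<forall>x\<in>{0..1}. F x = F 0 + integral\<^sup>L (lebesgue_on {0..x}) f)) \<longleftrightarrow> primitive_on 0 1 F f" for F f
  proof (cases "integrable (lebesgue_on {0..1}) f")
    case True
    then have ai: "f absolutely_integrable_on {0..1}" by (simp add: abs_integrable_lebesgue_on)
    have "integral\<^sup>L (lebesgue_on {0..x}) f = integral {0..x} f" if "x \<in> {0..1}" for x
      using abs_integrable_subinterval[OF ai, of 0 x] that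
      by (intro lebesgue_integral_eq_integral) (auto simp: abs_integrable_lebesgue_on)
    then have "(\<forall>x\<in>{0..1}. F x = F 0 + integral\<^sup>L (lebesgue_on {0..x}) f) \<longleftrightarrow>
        (\<forall>x\<in>{0..1}. F x = F 0 + integral {0..x} f)" by simp
    also have "\<dots> \<longleftrightarrow> primitive_on 0 1 F f"
    proof
      assume "primitive_on 0 1 F f"
      from primitive_onD(2)[OF this order_refl]
      have "F x - F 0 = integral {0..x} f" if "x \<in> {0..1}" for x using that by auto
      then show "\<forall>x\<in>{0..1}. F x = F 0 + integral {0..x} f" by (metis add.commute diff_eq_eq)
    qed (use primitive_on_from_left[OF ai, of F "F 0"] in \<open>metis atLeastAtMost_iff\<close>)
    finally show ?thesis using True by simp
  qed (auto simp: primitive_on_def abs_integrable_lebesgue_on)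
  then show ?thesis unfolding sob_chain_def by auto
qed

section \<open>Integration against a measure and membership in Lebesgue spaces\<close>

lemma continuous_abs_bound:
  fixes f :: "real \<Rightarrow> real"
  assumes "continuous_on {a..b} f"
  obtains C where "C > 0" "\<And>x. x \<in> {a..b} \<Longrightarrow> \<bar>f x\<bar> \<le> C"
proof -
  have "bounded (f ` {a..b})" by (intro compact_imp_bounded compact_continuous_image assms) auto
  then obtain C where "\<And>x. x \<in> {a..b} \<Longrightarrow> \<bar>f x\<bar> \<le> C" unfolding bounded_iff by fastforce
  then have "\<And>x. x \<in> {a..b} \<Longrightarrow> \<bar>f x\<bar> \<le> max C 1" by (meson max.coboundedI1)
  then show ?thesis using that[of "max C 1"] by auto
qed

text \<open>Fubini on the region y <= x turns integration against \<open>\<mu>\<close> into Lebesgue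
  integration against its tail. The closed tail \<open>{y..}\<close> matches the non-strict
  inequality, so atoms are counted correctly.\<close>

lemma integral_tail_measure:
  fixes h :: "real \<Rightarrow> real" and \<mu> :: "real measure"
  assumes sets: "sets \<mu> = sets (restrict_space borel {0..1})" and fin: "finite_measure \<mu>"
    and h: "continuous_on {0..1} h"
  shows "integral\<^sup>L \<mu> (\<lambda>x. integral {0..x} h) = integral {0..1} (\<lambda>y. measure \<mu> ({y..} \<inter> {0..1}) * h y)"
    and "(\<lambda>y. measure \<mu> ({y..} \<inter> {0..1}) * h y) absolutely_integrable_on {0..1}"
proof -
  let ?L = "lebesgue_on {0..1::real}"
  let ?f = "\<lambda>y x. indicator {..x} y * h y"
  have sp: "space \<mu> = {0..1}" using sets_eq_imp_space_eq[OF sets] by (simp add: space_restrict_space)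
  interpret L: finite_measure ?L by (intro finite_measure_lebesgue_on) auto
  interpret M: finite_measure \<mu> by (rule fin)
  interpret P: pair_sigma_finite ?L \<mu> by unfold_locales
  interpret Pf: finite_measure "?L \<Otimes>\<^sub>M \<mu>"
    by (rule finite_measure_pair_measure) unfold_locales
  have idm[measurable]: "(\<lambda>x. x) \<in> borel_measurable \<mu>" "(\<lambda>x. x) \<in> borel_measurable ?L"
  proof -
    have "(\<lambda>x. x) \<in> borel_measurable (restrict_space borel {0..1::real})"
      by (intro borel_measurable_continuous_on_restrict continuous_intros)
    then show "(\<lambda>x. x) \<in> borel_measurable \<mu>" using measurable_cong_sets[OF sets refl] by blast
    show "(\<lambda>x. x) \<in> borel_measurable ?L" using id_borel_measurable_lebesgue_on by (simp add: id_def)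
  qed
  have hm[measurable]: "h \<in> borel_measurable ?L"
    using h by (intro continuous_imp_measurable_on_sets_lebesgue) auto
  obtain C where C: "\<And>x. x \<in> {0..1} \<Longrightarrow> \<bar>h x\<bar> \<le> C" using continuous_abs_bound[OF h] by metis
  have [measurable]: "fst \<in> borel_measurable (?L \<Otimes>\<^sub>M \<mu>)" "snd \<in> borel_measurable (?L \<Otimes>\<^sub>M \<mu>)"
    using measurable_compose[OF measurable_fst idm(2)] measurable_compose[OF measurable_snd idm(1)] by auto
  have fm: "(\<lambda>z. (if fst z \<le> snd z then 1 else 0) * h (fst z)) \<in> borel_measurable (?L \<Otimes>\<^sub>M \<mu>)"
    by measurable
  have feq: "case_prod ?f = (\<lambda>z. (if fst z \<le> snd z then 1 else 0) * h (fst z))"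
    by (auto simp: fun_eq_iff indicator_def)
  have int: "integrable (?L \<Otimes>\<^sub>M \<mu>) (case_prod ?f)"
  proof (rule Pf.integrable_const_bound[where B=C])
    show "case_prod ?f \<in> borel_measurable (?L \<Otimes>\<^sub>M \<mu>)" using fm feq by simp
    have "norm (case_prod ?f z) \<le> C" if "z \<in> space (?L \<Otimes>\<^sub>M \<mu>)" for z
      using C[of "fst z"] that unfolding space_pair_measure by (auto simp: indicator_def)
    then show "AE z in ?L \<Otimes>\<^sub>M \<mu>. norm (case_prod ?f z) \<le> C" by (intro AE_I2)
  qed
  have inner1: "(\<integral>y. ?f y x \<partial>?L) = integral {0..x} h" if "x \<in> {0..1}" for x
  proof -
    have "(\<integral>y. ?f y x \<partial>?L) = (\<integral>y. (if y \<in> {0..x} then h y else 0) \<partial>?L)"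
      by (rule Bochner_Integration.integral_cong) (use that in \<open>auto simp: indicator_def\<close>)
    also have "\<dots> = integral\<^sup>L (lebesgue_on {0..x}) h"
      by (rule integral_restrict) (use that in auto)
    also have "\<dots> = integral {0..x} h"
    proof (rule lebesgue_integral_eq_integral)
      have "continuous_on {0..x} h" by (rule continuous_on_subset[OF h]) (use that in auto)
      from abs_integrable_continuous[OF this]
      show "integrable (lebesgue_on {0..x}) h" by (simp add: abs_integrable_lebesgue_on)
    qed simp
    finally show ?thesis .
  qed
  have inner2: "(\<integral>x. ?f y x \<partial>\<mu>) = measure \<mu> ({y..} \<inter> {0..1}) * h y" for y
  proof -
    have "(\<integral>x. ?f y x \<partial>\<mu>) = (\<integral>x. indicator ({y..} \<inter> {0..1}) x * h y \<partial>\<mu>)"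
      by (rule Bochner_Integration.integral_cong) (auto simp: sp indicator_def)
    also have "\<dots> = measure \<mu> (({y..} \<inter> {0..1}) \<inter> space \<mu>) * h y"
      by (cases "h y = 0") simp_all
    finally show ?thesis by (simp add: sp)
  qed
  have "integrable ?L (\<lambda>y. \<integral>x. ?f y x \<partial>\<mu>)"
    using P.integrable_fst[OF int] .
  then show ai: "(\<lambda>y. measure \<mu> ({y..} \<inter> {0..1}) * h y) absolutely_integrable_on {0..1}"
    unfolding inner2 by (simp add: abs_integrable_lebesgue_on)
  have "integral\<^sup>L \<mu> (\<lambda>x. integral {0..x} h) = (\<integral>x. (\<integral>y. ?f y x \<partial>?L) \<partial>\<mu>)"
    by (rule Bochner_Integration.integral_cong) (auto simp: inner1 sp)
  also have "\<dots> = (\<integral>y. (\<integral>x. ?f y x \<partial>\<mu>) \<partial>?L)" by (rule P.Fubini_integral[OF int])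
  also have "\<dots> = integral {0..1} (\<lambda>y. measure \<mu> ({y..} \<inter> {0..1}) * h y)"
    unfolding inner2 using ai by (intro lebesgue_integral_eq_integral) (auto simp: abs_integrable_lebesgue_on)
  finally show "integral\<^sup>L \<mu> (\<lambda>x. integral {0..x} h) = integral {0..1} (\<lambda>y. measure \<mu> ({y..} \<inter> {0..1}) * h y)" .
qed

text \<open>Completeness of Lebesgue measure gives \<open>h\<close> its measurability. Needed for
  integrands built from \<open>deriv\<close>, whose values are arbitrary where no derivative
  exists.\<close>

lemma lebesgue_integral_AE_cong:
  fixes f h :: "real \<Rightarrow> real"
  assumes f: "integrable (lebesgue_on {a..b}) f" and ae: "AE x in lebesgue_on {a..b}. f x = h x"
  shows "integral\<^sup>L (lebesgue_on {a..b}) h = integral\<^sup>L (lebesgue_on {a..b}) f"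
proof -
  obtain N where N: "N \<in> null_sets lebesgue" "{x\<in>{a..b}. f x \<noteq> h x} \<subseteq> N"
    using ae[unfolded AE_restrict_space_iff[of "{a..b}" lebesgue, simplified]]
    by (auto simp: eventually_ae_filter)
  then have neg: "negligible N" by (simp add: negligible_iff_null_sets)
  have eq: "h x = f x" if "x \<in> {a..b} - N" for x
    using N(2) that by (metis (mono_tags, lifting) DiffD1 DiffD2 mem_Collect_eq subsetD)
  have "h absolutely_integrable_on {a..b}"
    by (rule absolutely_integrable_spike[OF _ neg eq]) (use f in \<open>simp add: abs_integrable_lebesgue_on\<close>)
  then have h: "integrable (lebesgue_on {a..b}) h" by (simp add: abs_integrable_lebesgue_on)
  have "integral {a..b} f = integral {a..b} h" by (rule integral_spike[OF neg eq])
  then show ?thesis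
    using lebesgue_integral_eq_integral[OF f] lebesgue_integral_eq_integral[OF h] by simp
qed

lemma measurable_continuous_lebesgue:
  fixes f :: "real \<Rightarrow> real"
  assumes "continuous_on {a..b} f"
  shows "f \<in> borel_measurable (lebesgue_on {a..b})"
  using assms by (intro continuous_imp_measurable_on_sets_lebesgue) auto

lemma integrable_bound_lebesgue:
  fixes f g :: "real \<Rightarrow> real"
  assumes "integrable (lebesgue_on {a..b}) g" "f \<in> borel_measurable (lebesgue_on {a..b})"
    "\<And>x. x \<in> {a..b} \<Longrightarrow> \<bar>f x\<bar> \<le> g x"
  shows "integrable (lebesgue_on {a..b}) f"
  by (rule Bochner_Integration.integrable_bound[OF assms(1,2)])
    (use assms(3) in \<open>auto intro!: AE_I2 intro: order_trans[OF _ abs_ge_self]\<close>)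

lemma Lp_on_dominated:
  assumes v: "Lp_on q v" and q: "0 \<le> q" and f: "f \<in> borel_measurable (lebesgue_on {0..1})"
    and le: "\<And>x. x \<in> {0..1} \<Longrightarrow> \<bar>f x\<bar> \<le> C * (1 + \<bar>v x\<bar>)" and C: "0 \<le> C"
  shows "Lp_on q f"
  unfolding Lp_on_def
proof (intro conjI f)
  have [measurable]: "f \<in> borel_measurable (lebesgue_on {0..1})" by (rule f)
  have "integrable (lebesgue_on {0..1}) (\<lambda>x. (2 * C) powr q * (1 + \<bar>v x\<bar> powr q))"
    using v by (auto simp: Lp_on_def intro!: Bochner_Integration.integrable_add)
  then show "integrable (lebesgue_on {0..1}) (\<lambda>x. \<bar>f x\<bar> powr q)"
  proof (rule integrable_bound_lebesgue)
    fix x :: real assume x: "x \<in> {0..1}"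
    \<comment> \<open>Replacing the sum by a maximum lets \<open>powr q\<close> act on the two
      alternatives separately.\<close>
    have "1 + \<bar>v x\<bar> \<le> 2 * max 1 \<bar>v x\<bar>" by auto
    then have "\<bar>f x\<bar> \<le> (2 * C) * max 1 \<bar>v x\<bar>"
      using le[OF x] C mult_left_mono[of "1 + \<bar>v x\<bar>" "2 * max 1 \<bar>v x\<bar>" C] by (simp add: algebra_simps)
    then have "\<bar>f x\<bar> powr q \<le> ((2 * C) * max 1 \<bar>v x\<bar>) powr q"
      using q by (intro powr_mono2) auto
    also have "\<dots> = (2 * C) powr q * max 1 \<bar>v x\<bar> powr q"
      using C by (intro powr_mult)
    also have "\<dots> \<le> (2 * C) powr q * (1 + \<bar>v x\<bar> powr q)"
      by (intro mult_left_mono) (auto simp: max_def)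
    finally show "\<bar>\<bar>f x\<bar> powr q\<bar> \<le> (2 * C) powr q * (1 + \<bar>v x\<bar> powr q)" by simp
  qed measurable
qed

lemma Lp_on_bounded:
  assumes q: "0 \<le> q" and f: "f \<in> borel_measurable (lebesgue_on {0..1})"
    and le: "\<And>x. x \<in> {0..1} \<Longrightarrow> \<bar>f x\<bar> \<le> C"
  shows "Lp_on q f"
proof (rule Lp_on_dominated[where v = "\<lambda>_. 0"])
  show "Lp_on q (\<lambda>_. 0)" by (auto simp: Lp_on_def)
  show "\<bar>f x\<bar> \<le> C * (1 + \<bar>0\<bar>)" if "x \<in> {0..1}" for x using le[OF that] by simp
  show "0 \<le> C" using le[of 0] by auto
qed (use q f in auto)

lemma Lp_on_continuous:
  assumes "0 \<le> q" "continuous_on {0..1} f"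
  shows "Lp_on q f"
proof -
  obtain C where "\<And>x. x \<in> {0..1} \<Longrightarrow> \<bar>f x\<bar> \<le> C" using continuous_abs_bound[OF assms(2)] by metis
  then show ?thesis using assms by (intro Lp_on_bounded measurable_continuous_lebesgue)
qed

lemma Linf_on_continuous:
  assumes "continuous_on {0..1} f"
  shows "Linf_on f"
proof -
  obtain C where "\<And>x. x \<in> {0..1} \<Longrightarrow> \<bar>f x\<bar> \<le> C" using continuous_abs_bound[OF assms] by metis
  then show ?thesis unfolding Linf_on_def using assms
    by (auto intro!: measurable_continuous_lebesgue exI[of _ C])
qed

lemma primitive_on_derivative_open:
  assumes "primitive_on 0 1 F f" "continuous_on {0..1} f" "x \<in> {0<..<1}"
  shows "deriv F x = f x"
  using primitive_on_derivative[OF assms(1,2)] assms(3) by (intro DERIV_imp_deriv) auto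

lemma AE_interior: "AE x in lebesgue_on {0..1}. x \<in> {0<..<1::real}"
  unfolding AE_restrict_space_iff[of "{0..1}" lebesgue, simplified]
  by (rule AE_I'[of "{0,1}"]) auto

lemma deriv_eq_on_open:
  fixes F H :: "real \<Rightarrow> real"
  assumes "(H has_real_derivative D) (at x)" "x \<in> {0<..<1}" "\<And>y. y \<in> {0<..<1} \<Longrightarrow> F y = H y"
  shows "deriv F x = D"
proof (rule DERIV_imp_deriv)
  show "(F has_real_derivative D) (at x)"
    by (rule has_field_derivative_transform_within_open[OF assms(1), of "{0<..<1}"])
      (use assms in auto)
qed

lemma standing_G_derivatives:
  assumes "standing_G G"
  shows "(deriv G has_real_derivative deriv (deriv G) y) (at y)"
    and "(deriv (deriv G) has_real_derivative deriv (deriv (deriv G)) y) (at y)"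
proof -
  have *: "((deriv ^^ n) G) differentiable (at x)" for n x
    using assms by (simp add: standing_G_def)
  from *[of 1 y] show "(deriv G has_real_derivative deriv (deriv G) y) (at y)"
    by (simp add: DERIV_deriv_iff_real_differentiable)
  from *[of 2 y] show "(deriv (deriv G) has_real_derivative deriv (deriv (deriv G)) y) (at y)"
    by (simp add: DERIV_deriv_iff_real_differentiable numeral_2_eq_2)
qed

section \<open>The integrated Euler equation\<close>

text \<open>The witnesses hidden in the existential definitions become parameters: \<open>g\<close>
  is the first derivative of \<open>u\<close>, \<open>v\<close> a representative of the second, tied
  to \<open>g\<close> only through absolute continuity.\<close>

locale critical_point =
  fixes G :: "real \<Rightarrow> real" and p :: real and \<psi> u g v :: "real \<Rightarrow> real" and \<mu> :: "real measure"
  assumes G: "standing_G G" and p: "1 < p" and \<psi>: "standing_psi \<psi>"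
    and u_g: "primitive_on 0 1 u g" and g_v: "primitive_on 0 1 g v" and v_Lp: "Lp_on p v"
    and u_ends: "u 0 = 0" "u 1 = 0" and u_\<psi>: "\<And>x. x \<in> {0..1} \<Longrightarrow> \<psi> x \<le> u x"
    and sets_\<mu>: "sets \<mu> = sets (restrict_space borel {0..1})"
    and fin_\<mu>: "finite_measure \<mu>"
    and \<mu>_contact: "emeasure \<mu> ({0..1} - {x. u x = \<psi> x}) = 0"
    and euler: "\<And>\<phi>. sobolev 2 (Lp_on p) \<phi> \<Longrightarrow> W0_1p \<phi> \<Longrightarrow>
           - integral\<^sup>L (lebesgue_on {0..1})
               (\<lambda>x. euler_w G p u x * deriv (\<lambda>y. deriv G (deriv u y) * deriv \<phi> y) x)
           = integral\<^sup>L \<mu> \<phi>"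
begin

definition b :: "real \<Rightarrow> real" where "b x = inverse (deriv G (g x))"

text \<open>Not the derivative of \<open>b\<close>, which is \<open>b' x * v x\<close>: the
  continuous factor is split off from \<open>v\<close>, which is merely in L^p.\<close>

definition b' :: "real \<Rightarrow> real" where "b' x = - (deriv (deriv G) (g x) * (b x)\<^sup>2)"

(* The intersection matters: sets not contained in {0..1} are not measurable and would get measure 0. *)
definition m :: "real \<Rightarrow> real" where "m y = measure \<mu> ({y..} \<inter> {0..1})"

text \<open>The mean of \<open>m\<close> with weight \<open>b\<close>, the only constant for which
  \<open>k\<close> has integral 0 over \<open>{0..1}\<close>, so that \<open>K\<close> vanishes at
  both ends.\<close>

definition c :: real where "c = integral {0..1} (\<lambda>x. m x * b x) / integral {0..1} b"

definition k :: "real \<Rightarrow> real" where "k x = (m x - c) * b x"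

definition K :: "real \<Rightarrow> real" where "K x = integral {0..x} k"

text \<open>The counterpart of \<open>euler_w\<close> with weak derivatives in place of
  \<open>deriv\<close>; the two will be shown to agree almost everywhere.\<close>

definition w :: "real \<Rightarrow> real" where
  "w x = - p * deriv G (g x) powr (p - 1) * \<bar>v x\<bar> powr (p - 2) * v x"

lemma G'_pos: "0 < deriv G x" using G by (simp add: standing_G_def)

lemma cont_G': "continuous_on A (deriv G)" and cont_G'': "continuous_on A (deriv (deriv G))"
  using standing_G_derivatives[OF G] by (meson DERIV_isCont continuous_at_imp_continuous_on)+

lemma cont_g: "continuous_on {0..1} g" by (rule primitive_on_continuous[OF g_v])

lemma cont_u: "continuous_on {0..1} u" by (rule primitive_on_continuous[OF u_g])

lemma cont_G'g: "continuous_on {0..1} (\<lambda>x. deriv G (g x))"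
  by (rule continuous_on_compose2[OF cont_G'[of UNIV] cont_g]) auto

lemma b_pos: "0 < b x" by (simp add: b_def G'_pos)

lemma cont_b: "continuous_on {0..1} b"
  unfolding b_def using G'_pos by (intro continuous_intros cont_G'g) (auto simp: less_le)

lemma cont_b': "continuous_on {0..1} b'"
  unfolding b'_def
  by (intro continuous_intros cont_b continuous_on_compose2[OF cont_G''[of UNIV] cont_g]) auto

lemma primitive_b: "primitive_on 0 1 b (\<lambda>x. b' x * v x)"
proof -
  have "primitive_on 0 1 (\<lambda>x. inverse (deriv G (g x)))
      (\<lambda>x. - (inverse (deriv G (g x)) * deriv (deriv G) (g x) * inverse (deriv G (g x))) * v x)"
  proof (rule primitive_on_chain[OF g_v])
    show "((\<lambda>y. inverse (deriv G y)) has_real_derivative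
       - (inverse (deriv G y) * deriv (deriv G) y * inverse (deriv G y))) (at y)" for y
      by (rule DERIV_inverse'[OF standing_G_derivatives(1)[OF G]]) (use G'_pos[of y] in simp)
    show "continuous_on (g ` {0..1}) (\<lambda>y. - (inverse (deriv G y) * deriv (deriv G) y * inverse (deriv G y)))"
      by (intro continuous_intros cont_G' cont_G'') (use G'_pos in \<open>auto simp: less_le\<close>)
  qed
  then show ?thesis unfolding b_def[abs_def] b'_def[abs_def]
    by (simp add: power2_eq_square algebra_simps)
qed

lemma integral_b_pos: "0 < integral {0..1} b"
proof -
  have "b integrable_on {0..1}" by (intro integrable_continuous_real cont_b)
  moreover obtain x0 where "x0 \<in> {0..1}" "\<And>x. x \<in> {0..1} \<Longrightarrow> b x0 \<le> b x"
    using continuous_attains_inf[OF _ _ cont_b] by force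
  ultimately have "integral {0..1::real} (\<lambda>_. b x0) \<le> integral {0..1} b"
    by (intro integral_le) auto
  then show ?thesis using b_pos[of x0] by simp
qed

lemma m_antimono: "x \<le> y \<Longrightarrow> m y \<le> m x"
  unfolding m_def using sets_\<mu>
  by (intro finite_measure.finite_measure_mono[OF fin_\<mu>])
    (auto simp: sets_restrict_space_iff)

lemma m_nonneg: "0 \<le> m x" by (simp add: m_def)

lemma m_integrable: "continuous_on {0..1} h \<Longrightarrow> (\<lambda>x. m x * h x) absolutely_integrable_on {0..1}"
  unfolding m_def by (rule integral_tail_measure(2)[OF sets_\<mu> fin_\<mu>])

lemma k_integrable: "k absolutely_integrable_on {0..1}"
proof -
  have "(\<lambda>x. m x * b x - c * b x) absolutely_integrable_on {0..1}"
    by (intro set_integral_diff m_integrable abs_integrable_continuous continuous_intros cont_b)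
  then show ?thesis by (simp add: k_def[abs_def] algebra_simps)
qed

lemma primitive_K: "primitive_on 0 1 K k"
  unfolding K_def by (rule primitive_on_integral[OF k_integrable])

lemma K_ends: "K 0 = 0" "K 1 = 0"
proof -
  have "K 1 = integral {0..1} (\<lambda>x. m x * b x - c * b x)"
    by (simp add: K_def k_def[abs_def] algebra_simps)
  also have "\<dots> = integral {0..1} (\<lambda>x. m x * b x) - integral {0..1} (\<lambda>x. c * b x)"
    using m_integrable[OF cont_b] integrable_continuous_real[OF cont_b]
    by (intro Henstock_Kurzweil_Integration.integral_diff)
       (auto simp: absolutely_integrable_on_def intro: integrable_on_mult_right)
  also have "\<dots> = 0" using integral_b_pos by (simp add: c_def)
  finally show "K 1 = 0" .
qed (simp add: K_def)

lemma cont_K: "continuous_on {0..1} K" by (rule primitive_on_continuous[OF primitive_K])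

section \<open>From the weak equation to the identity \<open>w = K\<close>\<close>

lemma deriv_u: "x \<in> {0<..<1} \<Longrightarrow> deriv u x = g x"
  by (rule primitive_on_derivative_open[OF u_g cont_g])

text \<open>\<open>deriv u\<close> equals \<open>g\<close> at every interior point because
  \<open>g\<close> is continuous, whereas \<open>deriv (deriv u)\<close> is identified with
  \<open>v\<close> only where Lebesgue differentiation applies.\<close>

lemma euler_w_AE: "AE x in lebesgue_on {0..1}. euler_w G p u x = w x"
  using primitive_on_AE_derivative[OF g_v] AE_interior
proof eventually_elim
  case (elim x)
  have "deriv (deriv u) x = v x"
    by (rule deriv_eq_on_open[OF elim(1,2)]) (rule deriv_u)
  then show ?case using deriv_u[OF elim(2)] by (simp add: euler_w_def w_def)
qed

lemma v_measurable[measurable]: "v \<in> borel_measurable (lebesgue_on {0..1})"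
  using v_Lp by (simp add: Lp_on_def)

lemma G'g_measurable[measurable]: "(\<lambda>x. deriv G (g x)) \<in> borel_measurable (lebesgue_on {0..1})"
  by (rule measurable_continuous_lebesgue[OF cont_G'g])

lemma w_measurable[measurable]: "w \<in> borel_measurable (lebesgue_on {0..1})"
  unfolding w_def by measurable

lemma w_integrable: "integrable (lebesgue_on {0..1}) w"
proof -
  obtain C where C: "C > 0" "\<And>x. x \<in> {0..1} \<Longrightarrow> \<bar>deriv G (g x)\<bar> \<le> C"
    using continuous_abs_bound[OF cont_G'g] by metis
  have "integrable (lebesgue_on {0..1}) (\<lambda>x. p * C powr (p - 1) * (1 + \<bar>v x\<bar> powr p))"
    using v_Lp by (auto simp: Lp_on_def intro!: Bochner_Integration.integrable_add)
  then show ?thesis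
  proof (rule integrable_bound_lebesgue)
    fix x :: real assume x: "x \<in> {0..1}"
    \<comment> \<open>True also at \<open>v x = 0\<close> when p < 2, since
      \<open>0 powr (p - 2) = 0\<close>.\<close>
    have e: "\<bar>v x\<bar> powr (p - 2) * \<bar>v x\<bar> = \<bar>v x\<bar> powr (p - 1)"
      using powr_add[of "\<bar>v x\<bar>" "p - 2" 1] by (cases "v x = 0") auto
    have "\<bar>w x\<bar> = p * deriv G (g x) powr (p - 1) * \<bar>v x\<bar> powr (p - 1)"
      using p by (simp add: w_def abs_mult e[symmetric])
    also have "\<dots> \<le> p * C powr (p - 1) * (1 + \<bar>v x\<bar> powr p)"
    proof (intro mult_mono)
      show "deriv G (g x) powr (p - 1) \<le> C powr (p - 1)"
        using C(2)[OF x] G'_pos[of "g x"] p by (intro powr_mono2) auto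
      show "\<bar>v x\<bar> powr (p - 1) \<le> 1 + \<bar>v x\<bar> powr p"
      proof (cases "\<bar>v x\<bar> \<le> 1")
        case True
        then have "\<bar>v x\<bar> powr (p - 1) \<le> 1" using p by (intro powr_le1) auto
        then show ?thesis by (meson add_increasing2 powr_ge_zero)
      next
        case False
        then have "\<bar>v x\<bar> powr (p - 1) \<le> \<bar>v x\<bar> powr p" by (intro powr_mono) auto
        then show ?thesis by simp
      qed
    qed (use p in auto)
    finally show "\<bar>w x\<bar> \<le> p * C powr (p - 1) * (1 + \<bar>v x\<bar> powr p)" .
  qed measurable
qed

text \<open>Allowing every bounded measurable \<open>\<theta>\<close> admits the sign function used
  next, so no density argument is involved. Boundedness keeps \<open>\<phi>2\<close>, which contains
  \<open>b x * \<theta> x\<close>, in L^p.\<close>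

lemma euler_tested:
  assumes \<theta>m[measurable]: "\<theta> \<in> borel_measurable (lebesgue_on {0..1})"
    and \<theta>b: "\<And>x. x \<in> {0..1} \<Longrightarrow> \<bar>\<theta> x\<bar> \<le> B"
  shows "integral\<^sup>L (lebesgue_on {0..1}) (\<lambda>x. w x * \<theta> x) = integral {0..1} (\<lambda>x. K x * \<theta> x)"
proof -
  have "integrable (lebesgue_on {0..1::real}) (\<lambda>_. B)"
    using abs_integrable_continuous[of 0 1 "\<lambda>_. B"] by (simp add: abs_integrable_lebesgue_on)
  then have "integrable (lebesgue_on {0..1}) \<theta>"
    by (rule integrable_bound_lebesgue) (use \<theta>m \<theta>b in auto)
  then have \<theta>i: "\<theta> absolutely_integrable_on {0..1}" by (simp add: abs_integrable_lebesgue_on)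
  define T where "T x = integral {0..x} \<theta>" for x
  have T: "primitive_on 0 1 T \<theta>" unfolding T_def by (rule primitive_on_integral[OF \<theta>i])
  \<comment> \<open>The subtracted weighted mean is what gives \<open>\<phi> 1 = 0\<close>; being
    constant, it leaves the density \<open>\<theta>\<close> unchanged.\<close>
  define \<eta> where "\<eta> x = T x - integral {0..1} (\<lambda>x. T x * b x) / integral {0..1} b" for x
  have \<eta>: "primitive_on 0 1 \<eta> \<theta>" using T by (simp add: primitive_on_def \<eta>_def)
  have c\<eta>: "continuous_on {0..1} \<eta>" by (rule primitive_on_continuous[OF \<eta>])
  have cT: "continuous_on {0..1} T" by (rule primitive_on_continuous[OF T])
  \<comment> \<open>With this derivative of the test function, the product
    \<open>G'(u') * \<phi>'\<close> is exactly \<open>\<eta>\<close>, so its derivative in the weak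
    equation is \<open>\<theta>\<close>.\<close>
  define \<phi>1 where "\<phi>1 x = \<eta> x * b x" for x
  define \<phi>2 where "\<phi>2 x = b x * \<theta> x + \<eta> x * (b' x * v x)" for x
  define \<phi> where "\<phi> x = integral {0..x} \<phi>1" for x
  have \<phi>12: "primitive_on 0 1 \<phi>1 \<phi>2"
    unfolding \<phi>1_def \<phi>2_def by (rule primitive_on_mult[OF \<eta> primitive_b])
  have c\<phi>1: "continuous_on {0..1} \<phi>1" by (rule primitive_on_continuous[OF \<phi>12])
  have \<phi>: "primitive_on 0 1 \<phi> \<phi>1"
    unfolding \<phi>_def by (rule primitive_on_integral[OF abs_integrable_continuous[OF c\<phi>1]])
  have \<phi>_1: "\<phi> 1 = 0"
  proof -
    let ?q = "integral {0..1} (\<lambda>x. T x * b x) / integral {0..1} b"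
    have "\<phi> 1 = integral {0..1} (\<lambda>x. T x * b x - ?q * b x)"
      by (simp add: \<phi>_def \<phi>1_def[abs_def] \<eta>_def left_diff_distrib)
    also have "\<dots> = integral {0..1} (\<lambda>x. T x * b x) - integral {0..1} (\<lambda>x. ?q * b x)"
      by (intro Henstock_Kurzweil_Integration.integral_diff integrable_continuous_real continuous_intros cont_b cT)
    also have "\<dots> = 0" using integral_b_pos by simp
    finally show ?thesis .
  qed
  have "Lp_on p \<phi>2"
  proof -
    obtain C1 where C1: "C1 > 0" "\<And>x. x \<in> {0..1} \<Longrightarrow> \<bar>b x\<bar> \<le> C1" using continuous_abs_bound[OF cont_b] by metis
    have c2: "continuous_on {0..1} (\<lambda>x. \<eta> x * b' x)" by (intro continuous_intros c\<eta> cont_b')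
    obtain C2 where C2: "C2 > 0" "\<And>x. x \<in> {0..1} \<Longrightarrow> \<bar>\<eta> x * b' x\<bar> \<le> C2"
      using continuous_abs_bound[OF c2] by metis
    have B: "0 \<le> B" using \<theta>b[of 0] by auto
    show ?thesis
    proof (rule Lp_on_dominated[OF v_Lp, where C = "C1 * B + C2"])
      have "integrable (lebesgue_on {0..1}) \<phi>2"
        using primitive_onD(1)[OF \<phi>12] by (simp add: abs_integrable_lebesgue_on)
      then show "\<phi>2 \<in> borel_measurable (lebesgue_on {0..1})" by simp
      fix x :: real assume x: "x \<in> {0..1}"
      have "\<bar>\<phi>2 x\<bar> \<le> \<bar>b x\<bar> * \<bar>\<theta> x\<bar> + \<bar>\<eta> x * b' x\<bar> * \<bar>v x\<bar>"
        unfolding \<phi>2_def by (rule order_trans[OF abs_triangle_ineq]) (simp add: abs_mult)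
      also have "\<dots> \<le> C1 * B + C2 * \<bar>v x\<bar>"
        using C1(1) C1(2)[OF x] C2(2)[OF x] \<theta>b[OF x] by (intro add_mono mult_mono) simp_all
      also have "\<dots> \<le> (C1 * B + C2) * (1 + \<bar>v x\<bar>)"
        using C1(1) C2(1) B by (simp add: algebra_simps)
      finally show "\<bar>\<phi>2 x\<bar> \<le> (C1 * B + C2) * (1 + \<bar>v x\<bar>)" .
    qed (use p B C1(1) C2(1) in auto)
  qed
  moreover have "Lp_on p \<phi>1" "Lp_on p \<phi>"
    using p by (auto intro!: Lp_on_continuous c\<phi>1 primitive_on_continuous[OF \<phi>])
  ultimately have "sobolev 2 (Lp_on p) \<phi>"
    unfolding sobolev_def sob_chain_iff
    by (intro exI[of _ "\<lambda>j. if j = 0 then \<phi> else if j = 1 then \<phi>1 else \<phi>2"])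
      (use \<phi> \<phi>12 in \<open>auto simp: less_2_cases_iff\<close>)
  moreover have "W0_1p \<phi>" using \<phi>_1 by (simp add: W0_1p_def) (simp add: \<phi>_def)
  ultimately have eq: "- integral\<^sup>L (lebesgue_on {0..1})
               (\<lambda>x. euler_w G p u x * deriv (\<lambda>y. deriv G (deriv u y) * deriv \<phi> y) x)
           = integral\<^sup>L \<mu> \<phi>" by (rule euler)
  have ae: "AE x in lebesgue_on {0..1}. w x * \<theta> x = euler_w G p u x * deriv (\<lambda>y. deriv G (deriv u y) * deriv \<phi> y) x"
    using primitive_on_AE_derivative[OF \<eta>] AE_interior euler_w_AE
  proof eventually_elim
    case (elim x)
    have "deriv (\<lambda>y. deriv G (deriv u y) * deriv \<phi> y) x = \<theta> x"
    proof (rule deriv_eq_on_open[OF elim(1,2)])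
      fix y :: real assume y: "y \<in> {0<..<1}"
      then have "deriv \<phi> y = \<eta> y * b y"
        using primitive_on_derivative_open[OF \<phi> c\<phi>1 y] by (simp add: \<phi>1_def)
      then show "deriv G (deriv u y) * deriv \<phi> y = \<eta> y"
        using deriv_u[OF y] G'_pos[of "g y"] by (simp add: b_def)
    qed
    then show ?case using elim(3) by simp
  qed
  have w\<theta>: "integral\<^sup>L (lebesgue_on {0..1}) (\<lambda>x. w x * \<theta> x) = - integral\<^sup>L \<mu> \<phi>"
  proof -
    have "integrable (lebesgue_on {0..1}) (\<lambda>x. w x * \<theta> x)"
      by (rule integrable_bound_lebesgue[OF integrable_mult_left[OF integrable_abs[OF w_integrable], of B]])
        (use \<theta>b in \<open>auto simp: abs_mult intro!: mult_left_mono\<close>)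
    from lebesgue_integral_AE_cong[OF this ae] eq show ?thesis by simp
  qed
  have "integral\<^sup>L \<mu> \<phi> = integral {0..1} (\<lambda>y. m y * \<phi>1 y)"
    unfolding \<phi>_def m_def by (rule integral_tail_measure(1)[OF sets_\<mu> fin_\<mu> c\<phi>1])
  \<comment> \<open>Splitting \<open>m\<close> as \<open>(m - c) + c\<close> costs nothing: the
    constant part integrates to \<open>c * \<phi> 1 = 0\<close>.\<close>
  also have "\<dots> = integral {0..1} (\<lambda>y. \<eta> y * k y) + integral {0..1} (\<lambda>y. c * \<phi>1 y)"
  proof (subst Henstock_Kurzweil_Integration.integral_add[symmetric])
    show "(\<lambda>y. \<eta> y * k y) integrable_on {0..1}"
      using abs_integrable_mult_continuous[OF k_integrable c\<eta>] by (simp add: absolutely_integrable_on_def)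
    show "(\<lambda>y. c * \<phi>1 y) integrable_on {0..1}"
      by (intro integrable_continuous_real continuous_intros c\<phi>1)
  qed (simp add: k_def \<phi>1_def algebra_simps)
  also have "integral {0..1} (\<lambda>y. c * \<phi>1 y) = c * \<phi> 1" by (simp add: \<phi>_def)
  also have "integral {0..1} (\<lambda>y. \<eta> y * k y) = - integral {0..1} (\<lambda>y. K y * \<theta> y)"
  proof -
    \<comment> \<open>Integration by parts. \<open>\<eta>\<close> need not vanish at the ends; the
      boundary terms disappear because \<open>K\<close> does.\<close>
    have P: "primitive_on 0 1 (\<lambda>x. \<eta> x * K x) (\<lambda>x. K x * \<theta> x + \<eta> x * k x)"
      by (rule primitive_on_mult[OF \<eta> primitive_K])
    have "0 = integral {0..1} (\<lambda>x. K x * \<theta> x + \<eta> x * k x)"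
      using primitive_onD(2)[OF P, of 0 1] by (simp add: K_ends)
    also have "\<dots> = integral {0..1} (\<lambda>x. K x * \<theta> x) + integral {0..1} (\<lambda>x. \<eta> x * k x)"
      using abs_integrable_mult_continuous[OF k_integrable c\<eta>] abs_integrable_mult_continuous[OF \<theta>i cont_K]
      by (intro Henstock_Kurzweil_Integration.integral_add) (auto simp: absolutely_integrable_on_def)
    finally show ?thesis by simp
  qed
  finally show ?thesis using w\<theta> \<phi>_1 by simp
qed

text \<open>Testing with the sign of \<open>w - K\<close> makes the integral of
  \<open>\<bar>w x - K x\<bar>\<close> vanish.\<close>

lemma w_eq_K: "AE x in lebesgue_on {0..1}. w x = K x"
proof -
  let ?L = "lebesgue_on {0..1::real}"
  define \<theta> where "\<theta> x = sgn (w x - K x)" for x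
  have [measurable]: "K \<in> borel_measurable ?L" by (rule measurable_continuous_lebesgue[OF cont_K])
  have \<theta>m[measurable]: "\<theta> \<in> borel_measurable ?L" unfolding \<theta>_def by measurable
  have Ki: "integrable ?L K"
    using abs_integrable_continuous[OF cont_K] by (simp add: abs_integrable_lebesgue_on)
  have \<theta>1: "\<bar>\<theta> x\<bar> \<le> 1" for x by (simp add: \<theta>_def sgn_if)
  have i1: "integrable ?L (\<lambda>x. w x * \<theta> x)"
    by (rule integrable_bound_lebesgue[OF integrable_abs[OF w_integrable]])
       (use \<theta>1 in \<open>auto simp: abs_mult intro!: mult_left_le\<close>)
  have i2: "integrable ?L (\<lambda>x. K x * \<theta> x)"
    by (rule integrable_bound_lebesgue[OF integrable_abs[OF Ki]])
       (use \<theta>1 in \<open>auto simp: abs_mult intro!: mult_left_le\<close>)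
  have "integral\<^sup>L ?L (\<lambda>x. w x * \<theta> x) = integral\<^sup>L ?L (\<lambda>x. K x * \<theta> x)"
    using euler_tested[OF \<theta>m \<theta>1] lebesgue_integral_eq_integral[OF i2] by simp
  then have "integral\<^sup>L ?L (\<lambda>x. w x * \<theta> x - K x * \<theta> x) = 0" using i1 i2 by simp
  then have "integral\<^sup>L ?L (\<lambda>x. \<bar>w x - K x\<bar>) = 0"
    by (simp add: \<theta>_def left_diff_distrib[symmetric] abs_sgn[symmetric])
  then have "AE x in ?L. \<bar>w x - K x\<bar> = 0"
    using integral_nonneg_eq_0_iff_AE[of ?L "\<lambda>x. \<bar>w x - K x\<bar>"] Ki w_integrable by simp
  then show ?thesis by eventually_elim simp
qed


section \<open>Sign and shape of \<open>K\<close>\<close>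

lemma K_diff_ge:
  assumes st: "0 \<le> s" "s \<le> t" "t \<le> 1" and C: "\<And>x. s < x \<Longrightarrow> x < t \<Longrightarrow> C \<le> k x"
  shows "C * (t - s) \<le> K t - K s"
proof -
  \<comment> \<open>The bound is available only strictly between \<open>s\<close> and
    \<open>t\<close>, as the sign of \<open>k\<close> at a turning point is not controlled;
    redefining two end values does not alter the integral.\<close>
  let ?k = "\<lambda>x. if x \<in> {s<..<t} then k x else C"
  have neg: "negligible {s,t}" by simp
  have "k integrable_on {s..t}"
    using abs_integrable_subinterval[OF k_integrable] st by (simp add: absolutely_integrable_on_def)
  then have "?k integrable_on {s..t}" by (rule integrable_spike[OF _ neg]) auto
  then have "integral {s..t} (\<lambda>_. C) \<le> integral {s..t} ?k"
    by (intro integral_le) (use C in auto)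
  also have "\<dots> = integral {s..t} k" by (rule integral_spike[OF neg]) auto
  also have "\<dots> = K t - K s" using primitive_onD(2)[OF primitive_K, of s t] st by simp
  finally show ?thesis using st by (simp add: mult.commute)
qed

lemma K_diff_le:
  assumes st: "0 \<le> s" "s \<le> t" "t \<le> 1" and C: "\<And>x. s < x \<Longrightarrow> x < t \<Longrightarrow> k x \<le> C"
  shows "K t - K s \<le> C * (t - s)"
proof -
  let ?k = "\<lambda>x. if x \<in> {s<..<t} then k x else C"
  have neg: "negligible {s,t}" by simp
  have "k integrable_on {s..t}"
    using abs_integrable_subinterval[OF k_integrable] st by (simp add: absolutely_integrable_on_def)
  then have "?k integrable_on {s..t}" by (rule integrable_spike[OF _ neg]) auto
  then have "integral {s..t} ?k \<le> integral {s..t} (\<lambda>_. C)"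
    by (intro integral_le) (use C in auto)
  moreover have "integral {s..t} ?k = integral {s..t} k"
    by (rule integral_spike[OF neg]) auto
  moreover have "integral {s..t} k = K t - K s" using primitive_onD(2)[OF primitive_K, of s t] st by simp
  ultimately show ?thesis using st by (simp add: mult.commute)
qed

lemma b_lower:
  obtains \<beta> where "\<beta> > 0" "\<And>x. x \<in> {0..1} \<Longrightarrow> \<beta> \<le> b x"
proof -
  obtain x0 where "x0 \<in> {0..1}" "\<And>x. x \<in> {0..1} \<Longrightarrow> b x0 \<le> b x"
    using continuous_attains_inf[OF _ _ cont_b] by force
  then show ?thesis using that[of "b x0"] b_pos by blast
qed

lemma space_\<mu>: "space \<mu> = {0..1}"
  using sets_eq_imp_space_eq[OF sets_\<mu>] by (simp add: space_restrict_space)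

lemma measure_off_contact:
  assumes S: "S \<in> sets \<mu>" and off: "\<And>x. x \<in> S \<Longrightarrow> u x \<noteq> \<psi> x"
  shows "measure \<mu> S = 0"
proof -
  interpret M: finite_measure \<mu> by (rule fin_\<mu>)
  have "continuous_on {0..1} (\<lambda>x. u x - \<psi> x)"
    using \<psi> by (intro continuous_intros cont_u) (simp add: standing_psi_def)
  from borel_measurable_continuous_on_restrict[OF this]
  have [measurable]: "(\<lambda>x. u x - \<psi> x) \<in> borel_measurable \<mu>"
    using measurable_cong_sets[OF sets_\<mu> refl] by blast
  \<comment> \<open>Measurability has to precede the use of \<open>\<mu>_contact\<close>:
    \<open>emeasure\<close> is 0 on non-measurable sets by convention, so the value alone would say
    nothing.\<close>
  have "{x \<in> space \<mu>. u x - \<psi> x \<noteq> 0} \<in> sets \<mu>" by measurable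
  moreover have "{x \<in> space \<mu>. u x - \<psi> x \<noteq> 0} = {0..1} - {x. u x = \<psi> x}" by (auto simp: space_\<mu>)
  ultimately have N: "{0..1} - {x. u x = \<psi> x} \<in> sets \<mu>" by simp
  have "S \<subseteq> {0..1} - {x. u x = \<psi> x}" using off sets.sets_into_space[OF S] by (auto simp: space_\<mu>)
  then have "measure \<mu> S \<le> measure \<mu> ({0..1} - {x. u x = \<psi> x})" by (intro M.finite_measure_mono N)
  also have "\<dots> = 0" using \<mu>_contact by (simp add: measure_def)
  finally show ?thesis using measure_nonneg[of \<mu> S] by linarith
qed

text \<open>Since tails are closed, \<open>m s\<close> and \<open>m t\<close> differ by the mass of
  the half-open \<open>{s..<t}\<close>. Contact at \<open>t\<close> itself is thus allowed, which
  matters at the tip of the tent.\<close>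

lemma m_eq_if_no_contact:
  assumes st: "0 \<le> s" "s \<le> t" "t \<le> 1" and off: "\<And>x. s \<le> x \<Longrightarrow> x < t \<Longrightarrow> u x \<noteq> \<psi> x"
  shows "m s = m t"
proof -
  interpret M: finite_measure \<mu> by (rule fin_\<mu>)
  have sets: "{t..} \<inter> {0..1} \<in> sets \<mu>" "{s..<t} \<in> sets \<mu>"
    using st by (auto simp: sets_\<mu> sets_restrict_space_iff)
  have "{s..} \<inter> {0..1} = ({t..} \<inter> {0..1}) \<union> {s..<t}" using st by auto
  then have "m s \<le> m t + measure \<mu> {s..<t}"
    unfolding m_def using measure_Un_le[OF sets] by simp
  also have "measure \<mu> {s..<t} = 0" using off by (intro measure_off_contact sets) auto
  finally show ?thesis using m_antimono[OF st(2)] by simp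
qed

lemma m_zero_if_no_contact:
  assumes s: "0 \<le> s" and off: "\<And>x. s \<le> x \<Longrightarrow> x \<le> 1 \<Longrightarrow> u x \<noteq> \<psi> x"
  shows "m s = 0"
  unfolding m_def
  by (rule measure_off_contact) (use off in \<open>auto simp: sets_\<mu> sets_restrict_space_iff\<close>)

text \<open>At both ends \<open>u = 0 > \<psi>\<close>, so by continuity there is no contact, hence
  no mass, in a neighbourhood.\<close>

lemma m_near_ends:
  obtains d where "0 < d" "d < 1/2" "\<And>y. 0 \<le> y \<Longrightarrow> y \<le> d \<Longrightarrow> m y = m 0"
    "\<And>y. 1 - d \<le> y \<Longrightarrow> y \<le> 1 \<Longrightarrow> m y = 0"
proof -
  have cont: "continuous_on {0..1} (\<lambda>x. u x - \<psi> x)"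
    using \<psi> by (intro continuous_intros cont_u) (simp add: standing_psi_def)
  have pos: "0 < u 0 - \<psi> 0" "0 < u 1 - \<psi> 1" using \<psi> u_ends by (auto simp: standing_psi_def)
  obtain d1 where d1: "d1 > 0" "\<And>x. x \<in> {0..1} \<Longrightarrow> dist x 0 < d1 \<Longrightarrow> dist (u x - \<psi> x) (u 0 - \<psi> 0) < u 0 - \<psi> 0"
    using cont[unfolded continuous_on_iff, rule_format, of 0 "u 0 - \<psi> 0"] pos by auto
  obtain d2 where d2: "d2 > 0" "\<And>x. x \<in> {0..1} \<Longrightarrow> dist x 1 < d2 \<Longrightarrow> dist (u x - \<psi> x) (u 1 - \<psi> 1) < u 1 - \<psi> 1"
    using cont[unfolded continuous_on_iff, rule_format, of 1 "u 1 - \<psi> 1"] pos by auto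
  define d where "d = min (min d1 d2) (1/2) / 2"
  have d: "0 < d" "d < 1/2" "d < d1" "d < d2" using d1 d2 by (auto simp: d_def min_def)
  have off0: "u x \<noteq> \<psi> x" if "0 \<le> x" "x \<le> d" for x
    using d1(2)[of x] that d by (auto simp: dist_real_def)
  have off1: "u x \<noteq> \<psi> x" if "1 - d \<le> x" "x \<le> 1" for x
    using d2(2)[of x] that d by (auto simp: dist_real_def)
  show ?thesis
  proof (rule that[OF d(1,2)])
    show "m y = m 0" if "0 \<le> y" "y \<le> d" for y
      using m_eq_if_no_contact[of 0 y] off0 that d by simp
    show "m y = 0" if "1 - d \<le> y" "y \<le> 1" for y
      using m_zero_if_no_contact[of y] off1 that d by simp
  qed
qed

text \<open>Without mass \<open>K = 0\<close>, so the second derivative vanishes almost everywhere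
  and \<open>u\<close> is affine with zero boundary values, hence 0, which contradicts
  \<open>\<psi> x0 > 0\<close>.\<close>

lemma m0_pos: "0 < m 0"
proof (rule ccontr)
  assume "\<not> 0 < m 0"
  then have m: "m x = 0" if "0 \<le> x" for x
    using m_nonneg[of x] m_antimono[OF that] by simp
  have "integral {0..1} (\<lambda>x. m x * b x) = integral {0..1} (\<lambda>x::real. 0::real)"
    by (rule Henstock_Kurzweil_Integration.integral_cong) (simp add: m)
  then have c0: "c = 0" by (simp add: c_def)
  have K0: "K x = 0" for x
  proof -
    have "K x = integral {0..x} (\<lambda>x::real. 0::real)" unfolding K_def
      by (rule Henstock_Kurzweil_Integration.integral_cong) (simp add: k_def m c0)
    then show ?thesis by simp
  qed
  have "AE x in lebesgue_on {0..1}. v x = 0"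
    using w_eq_K
  proof eventually_elim
    case (elim x)
    then show ?case using p G'_pos[of "g x"] by (auto simp: w_def K0)
  qed
  then have g0: "primitive_on 0 1 g (\<lambda>_. 0)" by (intro primitive_on_AE[OF g_v]) auto
  obtain q where gc: "\<And>x. x \<in> {0..1} \<Longrightarrow> g x = q"
  proof
    fix x :: real assume "x \<in> {0..1}"
    then show "g x = g 0" using primitive_onD(2)[OF g0, of 0 x] by simp
  qed
  have ux: "u x = x * q" if "x \<in> {0..1}" for x
  proof -
    have "integral {0..x} g = integral {0..x} (\<lambda>_. q)"
      by (rule Henstock_Kurzweil_Integration.integral_cong) (use gc that in auto)
    then show ?thesis using primitive_onD(2)[OF u_g, of 0 x] that u_ends by simp
  qed
  from ux[of 1] u_ends have "q = 0" by simp
  then have "u x = 0" if "x \<in> {0..1}" for x using ux[OF that] by simp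
  moreover obtain x0 where "x0 \<in> {0<..<1}" "\<psi> x0 > 0" using \<psi> by (auto simp: standing_psi_def)
  ultimately show False using u_\<psi>[of x0] by fastforce
qed

text \<open>If \<open>c <= 0\<close>, then \<open>k >= 0\<close> with a positive lower bound near 0;
  if \<open>c >= m 0\<close>, then \<open>k <= 0\<close> with a negative upper bound near 1. Either
  way \<open>K 0 = K 1\<close> fails.\<close>

lemma c_bounds: "0 < c" "c < m 0"
proof -
  obtain d where d: "0 < d" "d < 1/2" and d3: "\<And>y. 0 \<le> y \<Longrightarrow> y \<le> d \<Longrightarrow> m y = m 0"
    and d4: "\<And>y. 1 - d \<le> y \<Longrightarrow> y \<le> 1 \<Longrightarrow> m y = 0" using m_near_ends by metis
  obtain \<beta> where \<beta>: "\<beta> > 0" "\<And>x. x \<in> {0..1} \<Longrightarrow> \<beta> \<le> b x" using b_lower by metis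
  show "0 < c"
  proof (rule ccontr)
    assume c: "\<not> 0 < c"
    have "m 0 * \<beta> * (d - 0) \<le> K d - K 0"
    proof (rule K_diff_ge)
      fix x assume x: "0 < x" "x < d"
      then show "m 0 * \<beta> \<le> k x" unfolding k_def
        using c d d3[of x] x \<beta>(2)[of x] \<beta>(1) m0_pos by (intro mult_mono) auto
    qed (use d in auto)
    moreover have "0 * (1 - d) \<le> K 1 - K d"
    proof (rule K_diff_ge)
      fix x :: real show "0 \<le> k x" unfolding k_def
        using c m_nonneg[of x] b_pos[of x] by (intro mult_nonneg_nonneg) auto
    qed (use d in auto)
    ultimately show False using K_ends mult_pos_pos[OF mult_pos_pos[OF m0_pos \<beta>(1)] d(1)] by simp
  qed
  then have "0 < c" .
  show "c < m 0"
  proof (rule ccontr)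
    assume c: "\<not> c < m 0"
    have "K 1 - K (1 - d) \<le> - (m 0 * \<beta>) * (1 - (1 - d))"
    proof (rule K_diff_le)
      fix x assume x: "1 - d < x" "x < 1"
      have "m 0 * \<beta> \<le> c * b x"
        using c \<beta> x d m0_pos by (intro mult_mono) auto
      then show "k x \<le> - (m 0 * \<beta>)" unfolding k_def using d4[of x] x by auto
    qed (use d in auto)
    moreover have "K (1 - d) - K 0 \<le> 0 * (1 - d - 0)"
    proof (rule K_diff_le)
      fix x :: real assume "0 < x"
      then show "k x \<le> 0" unfolding k_def
        using c m_antimono[of 0 x] b_pos[of x] by (intro mult_nonpos_nonneg) auto
    qed (use d in auto)
    ultimately show False using K_ends mult_pos_pos[OF mult_pos_pos[OF m0_pos \<beta>(1)] d(1)] by simp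
  qed
qed

text \<open>As \<open>m\<close> is antitone, \<open>k\<close> changes sign once, at the supremum
  \<open>z\<close> of the points with \<open>c <= m x\<close>. Near the ends \<open>k\<close> is
  bounded away from 0, giving linear growth; in between, monotonicity preserves the value reached at
  distance \<open>d\<close>.\<close>

lemma K_unimodal:
  obtains z \<kappa> where "0 < z" "z < 1" "\<kappa> > 0"
    "\<And>s t. 0 \<le> s \<Longrightarrow> s \<le> t \<Longrightarrow> t \<le> z \<Longrightarrow> K s \<le> K t"
    "\<And>s t. z \<le> s \<Longrightarrow> s \<le> t \<Longrightarrow> t \<le> 1 \<Longrightarrow> K t \<le> K s"
    "\<And>x. 0 \<le> x \<Longrightarrow> x \<le> z \<Longrightarrow> \<kappa> * x \<le> K x"
    "\<And>x. z \<le> x \<Longrightarrow> x \<le> 1 \<Longrightarrow> \<kappa> * (1 - x) \<le> K x"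
proof -
  obtain d where d: "0 < d" "d < 1/2" and d3: "\<And>y. 0 \<le> y \<Longrightarrow> y \<le> d \<Longrightarrow> m y = m 0"
    and d4: "\<And>y. 1 - d \<le> y \<Longrightarrow> y \<le> 1 \<Longrightarrow> m y = 0" using m_near_ends by metis
  obtain \<beta> where \<beta>: "\<beta> > 0" "\<And>x. x \<in> {0..1} \<Longrightarrow> \<beta> \<le> b x" using b_lower by metis
  define S where "S = {x \<in> {0..1}. c \<le> m x}"
  define z where "z = Sup S"
  have bdd: "bdd_above S" by (auto simp: S_def intro!: bdd_aboveI[of _ 1])
  have dS: "d \<in> S" using d c_bounds d3[of d] by (auto simp: S_def)
  have dz: "d \<le> z" unfolding z_def using dS bdd by (rule cSup_upper)
  have zd: "z \<le> 1 - d" unfolding z_def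
  proof (rule cSup_least)
    show "x \<le> 1 - d" if "x \<in> S" for x
      using that d4[of x] c_bounds by (cases "x \<le> 1 - d") (auto simp: S_def)
  qed (use dS in auto)
  have k1: "0 \<le> k x" if x: "x < z" for x
  proof -
    obtain y where "y \<in> S" "x < y" using less_cSupD[of S x] dS x by (auto simp: z_def)
    then show ?thesis using m_antimono[of x y] b_pos[of x] by (auto simp: S_def k_def)
  qed
  have k2: "k x \<le> 0" if x: "z < x" "x \<le> 1" for x
  proof -
    have "x \<notin> S" using x cSup_upper[OF _ bdd, of x] by (auto simp: z_def)
    then have "m x \<le> c" using x dz d(1) by (auto simp: S_def)
    then show ?thesis using b_pos[of x] by (simp add: k_def mult_nonpos_nonneg)
  qed
  have mono: "K s \<le> K t" if "0 \<le> s" "s \<le> t" "t \<le> z" for s t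
    using K_diff_ge[of s t 0] k1 that zd d by auto
  have anti: "K t \<le> K s" if "z \<le> s" "s \<le> t" "t \<le> 1" for s t
    using K_diff_le[of s t 0] k2 that dz d by auto
  \<comment> \<open>\<open>k\<close> equals \<open>(m 0 - c) * b\<close> near 0 and
    \<open>- c * b\<close> near 1; \<open>\<gamma>\<close> lies below both moduli.\<close>
  define \<gamma> where "\<gamma> = min (m 0 - c) c * \<beta>"
  have \<gamma>: "\<gamma> > 0" using c_bounds \<beta> by (simp add: \<gamma>_def)
  have low0: "\<gamma> * x \<le> K x" if x: "0 \<le> x" "x \<le> d" for x
  proof -
    have "\<gamma> * (x - 0) \<le> K x - K 0"
    proof (rule K_diff_ge)
      fix y assume y: "0 < y" "y < x"
      then show "\<gamma> \<le> k y" unfolding \<gamma>_def k_def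
        using d3[of y] x d c_bounds \<beta>(1) \<beta>(2)[of y] by (intro mult_mono) auto
    qed (use x d in auto)
    then show ?thesis by (simp add: K_ends)
  qed
  have low1: "\<gamma> * (1 - x) \<le> K x" if x: "1 - d \<le> x" "x \<le> 1" for x
  proof -
    have "K 1 - K x \<le> (- \<gamma>) * (1 - x)"
    proof (rule K_diff_le)
      fix y assume y: "x < y" "y < 1"
      have "\<gamma> \<le> c * b y" unfolding \<gamma>_def
        using x d y c_bounds \<beta>(1) \<beta>(2)[of y] by (intro mult_mono) auto
      then show "k y \<le> - \<gamma>" unfolding k_def using d4[of y] x y by auto
    qed (use x d in auto)
    then show ?thesis by (simp add: K_ends)
  qed
  have d1: "d * \<gamma> \<le> \<gamma>" using \<gamma> d by simp
  show ?thesis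
  \<comment> \<open>Away from the ends only \<open>K x >= \<gamma> * d\<close> is known, so the
    slope shrinks to \<open>d * \<gamma>\<close>, the distance to the end being at most 1; by
    \<open>d < 1\<close> it also serves near the ends.\<close>
  proof (rule that[of z "d * \<gamma>"])
    show "d * \<gamma> * x \<le> K x" if x: "0 \<le> x" "x \<le> z" for x
    proof (cases "x \<le> d")
      case True
      have "d * \<gamma> * x \<le> \<gamma> * x" using d1 x by (intro mult_right_mono) auto
      then show ?thesis using low0[of x] True x by simp
    next
      case False
      have "d * \<gamma> * x \<le> \<gamma> * d" using x zd d \<gamma> by (simp add: mult_left_le)
      also have "\<dots> \<le> K d" using low0[of d] d by simp
      also have "\<dots> \<le> K x" using mono[of d x] False x d by simp
      finally show ?thesis .
    qed
    show "d * \<gamma> * (1 - x) \<le> K x" if x: "z \<le> x" "x \<le> 1" for x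
    proof (cases "1 - d \<le> x")
      case True
      have "d * \<gamma> * (1 - x) \<le> \<gamma> * (1 - x)" using d1 x by (intro mult_right_mono) auto
      then show ?thesis using low1[of x] True x by simp
    next
      case False
      have "d * \<gamma> * (1 - x) \<le> \<gamma> * d" using x dz d \<gamma> by (simp add: mult_left_le)
      also have "\<dots> \<le> K (1 - d)" using low1[of "1 - d"] d by simp
      also have "\<dots> \<le> K x" using anti[of x "1 - d"] False x d by simp
      finally show ?thesis .
    qed
  qed (use dz zd d \<gamma> mono anti in auto)
qed

lemma K_pos: assumes "x \<in> {0<..<1}" shows "0 < K x"
proof -
  obtain z \<kappa> where z: "0 < z" "z < 1" "\<kappa> > 0"
    "\<And>x. 0 \<le> x \<Longrightarrow> x \<le> z \<Longrightarrow> \<kappa> * x \<le> K x"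
    "\<And>x. z \<le> x \<Longrightarrow> x \<le> 1 \<Longrightarrow> \<kappa> * (1 - x) \<le> K x" using K_unimodal by metis
  have "0 < \<kappa> * x" "0 < \<kappa> * (1 - x)" using z(3) assms by auto
  then show ?thesis using z(4)[of x] z(5)[of x] assms by (cases "x \<le> z") auto
qed

lemma K_nonneg: "x \<in> {0..1} \<Longrightarrow> 0 \<le> K x"
  using K_pos[of x] K_ends by (cases "x = 0 \<or> x = 1") (auto simp: less_le)

section \<open>The second derivative and concavity\<close>

definition \<alpha> :: real where "\<alpha> = 1 / (p - 1)"

definition u2 :: "real \<Rightarrow> real" where "u2 x = - ((K x / p) powr \<alpha> * b x)"

lemma \<alpha>_pos: "0 < \<alpha>" using p by (simp add: \<alpha>_def)

lemma cont_u2: "continuous_on {0..1} u2"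
  unfolding u2_def using p \<alpha>_pos K_nonneg
  by (intro continuous_intros cont_K cont_b continuous_on_powr') auto

text \<open>\<open>w\<close> has the sign opposite to \<open>v\<close>, so \<open>K > 0\<close>
  forces \<open>v < 0\<close>. The absolute value then resolves to \<open>- v\<close>, and
  \<open>w = K\<close> is inverted by raising to the power \<open>\<alpha>\<close>.\<close>

lemma v_eq_u2: "AE x in lebesgue_on {0..1}. v x = u2 x"
  using w_eq_K AE_interior
proof eventually_elim
  case (elim x)
  let ?a = "deriv G (g x)"
  have a: "?a > 0" by (rule G'_pos)
  have K: "K x > 0" by (rule K_pos[OF elim(2)])
  have v: "v x < 0"
  proof (rule ccontr)
    assume "\<not> v x < 0"
    then have "w x \<le> 0" using p by (simp add: w_def)
    then show False using elim K by simp
  qed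
  have "(- v x) powr (p - 2) * (- v x) = (- v x) powr (p - 1)"
    using powr_add[of "- v x" "p - 2" 1] v by simp
  then have "(- v x) powr (p - 1) = (- v x) powr (p - 2) * (- v x)" ..
  then have "w x = p * ?a powr (p - 1) * (- v x) powr (p - 1)"
    by (simp only: w_def abs_of_neg[OF v])
  then have "K x / p = (?a * (- v x)) powr (p - 1)"
    unfolding powr_mult using elim(1) p by simp
  then have "(K x / p) powr \<alpha> = ?a * (- v x)"
    using p a v by (simp add: powr_powr \<alpha>_def abs_mult)
  then show ?case using a by (simp add: u2_def b_def)
qed

text \<open>The gain of regularity: \<open>u2\<close> is continuous, so \<open>g\<close> is
  continuously differentiable and \<open>u\<close> is C^2.\<close>

lemma primitive_g_u2: "primitive_on 0 1 g u2"
  by (rule primitive_on_AE[OF g_v v_eq_u2 measurable_continuous_lebesgue[OF cont_u2]])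

lemma primitive_b_u2: "primitive_on 0 1 b (\<lambda>x. b' x * u2 x)"
proof (rule primitive_on_AE[OF primitive_b])
  show "AE x in lebesgue_on {0..1}. b' x * v x = b' x * u2 x"
    using v_eq_u2 by eventually_elim simp
qed (intro measurable_continuous_lebesgue continuous_intros cont_b' cont_u2)

lemma u2_neg: "x \<in> {0<..<1} \<Longrightarrow> u2 x < 0"
  using K_pos[of x] b_pos[of x] p by (simp add: u2_def)

lemma u2_ends: "u2 0 = 0" "u2 1 = 0" by (simp_all add: u2_def K_ends)

lemma C2: "C2_closed_with u g u2"
  unfolding C2_closed_with_def
  using cont_u2 primitive_on_derivative_within[OF u_g cont_g]
    primitive_on_derivative_within[OF primitive_g_u2 cont_u2] by blast

lemma g_strict_antimono:
  assumes "0 \<le> s" "s < t" "t \<le> 1"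
  shows "g t < g s"
proof -
  obtain z where z: "s < z" "z < t" "g t - g s = (t - s) * u2 z"
    using primitive_on_mvt[OF primitive_g_u2 cont_u2 assms] .
  have "(t - s) * u2 z < 0" using u2_neg[of z] z assms by (intro mult_pos_neg) auto
  then show ?thesis using z by simp
qed

text \<open>Strictness comes from \<open>u2 < 0\<close> inside the interval and is essential for the
  tent: a merely concave \<open>u\<close> could run along one of its sides.\<close>

lemma u_below_tangent:
  assumes "x \<in> {0..1}" "y \<in> {0..1}" "x \<noteq> y"
  shows "u y < u x + g x * (y - x)"
proof (cases "x < y")
  case True
  then obtain z where z: "x < z" "z < y" "u y - u x = (y - x) * g z"
    using primitive_on_mvt[OF u_g cont_g, of x y] assms by auto
  have "(y - x) * g z < (y - x) * g x"
    using True z assms by (intro mult_strict_left_mono g_strict_antimono) auto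
  then show ?thesis using z by (simp add: algebra_simps)
next
  case False
  then have yx: "y < x" using assms by auto
  then obtain z where z: "y < z" "z < x" "u x - u y = (x - y) * g z"
    using primitive_on_mvt[OF u_g cont_g, of y x] assms by auto
  have "(x - y) * g x < (x - y) * g z"
    using yx z assms by (intro mult_strict_left_mono g_strict_antimono) auto
  then show ?thesis using z by (simp add: algebra_simps)
qed

lemma concave: "concave_on {0..1} u"
proof (rule concave_on_linorderI)
  fix t x y :: real assume t: "0 < t" "t < 1" and x: "x \<in> {0..1}" and y: "y \<in> {0..1}" and xy: "x < y"
  let ?z = "(1 - t) *\<^sub>R x + t *\<^sub>R y"
  have zx: "?z - x = t * (y - x)" and yz: "y - ?z = (1 - t) * (y - x)" by (simp_all add: algebra_simps)
  have "?z - x > 0" "y - ?z > 0" unfolding zx yz using t xy by auto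
  then have z: "?z \<in> {0..1}" "?z \<noteq> x" "?z \<noteq> y" using x y by auto
  \<comment> \<open>Two tangent bounds at the intermediate point; their linear parts cancel in the
    weighted sum.\<close>
  have "(1 - t) * u x + t * u y \<le> (1 - t) * (u ?z + g ?z * (x - ?z)) + t * (u ?z + g ?z * (y - ?z))"
    using u_below_tangent[OF z(1) x z(2)] u_below_tangent[OF z(1) y z(3)] t
    by (intro add_mono mult_left_mono) auto
  also have "\<dots> = u ?z + g ?z * ((1 - t) * (x - ?z) + t * (y - ?z))" by (simp add: algebra_simps)
  also have "(1 - t) * (x - ?z) + t * (y - ?z) = 0" by (simp add: algebra_simps)
  finally show "(1 - t) * u x + t * u y \<le> u ?z" by simp
qed simp

end

section \<open>The third derivative\<close>

lemma bv_open_partition_mem: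
  fixes t :: "nat \<Rightarrow> real"
  assumes "\<forall>i<n. t i \<le> t (Suc i)" "0 < t 0" "t n < 1" "i \<le> n"
  shows "t i \<in> {0<..<1}"
proof -
  have mono: "t i \<le> t j" if "i \<le> j" "j \<le> n" for i j
    using that by (induction j) (use assms(1) in \<open>auto simp: le_Suc_eq intro: order_trans\<close>)
  from mono[of 0 i] mono[of i n] assms show ?thesis by auto
qed

text \<open>The increments of the majorant telescope. Used with \<open>V = f\<close> for monotone
  functions, and with the integral of the modulus of the density for primitives.\<close>

lemma bv_open_dominated:
  assumes V: "\<And>s t. 0 < s \<Longrightarrow> s \<le> t \<Longrightarrow> t < 1 \<Longrightarrow> \<bar>f t - f s\<bar> \<le> V t - V s"
    and B: "\<And>s t. 0 < s \<Longrightarrow> s \<le> t \<Longrightarrow> t < 1 \<Longrightarrow> V t - V s \<le> B"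
  shows "bv_open f"
  unfolding bv_open_def
proof (intro exI[of _ B] allI impI)
  fix n :: nat and t :: "nat \<Rightarrow> real" assume t: "(\<forall>i<n. t i \<le> t (Suc i)) \<and> 0 < t 0 \<and> t n < 1"
  then have mem: "t i \<in> {0<..<1}" if "i \<le> n" for i using bv_open_partition_mem[of n t i] that by blast
  have mono: "t 0 \<le> t i" if "i \<le> n" for i
    using that by (induction i) (use t in \<open>auto intro: order_trans\<close>)
  have "(\<Sum>i<n. \<bar>f (t (Suc i)) - f (t i)\<bar>) \<le> (\<Sum>i<n. V (t (Suc i)) - V (t i))"
  proof (rule sum_mono)
    fix i assume i: "i \<in> {..<n}"
    then show "\<bar>f (t (Suc i)) - f (t i)\<bar> \<le> V (t (Suc i)) - V (t i)"
      using t mem[of i] mem[of "Suc i"] by (intro V) auto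
  qed
  also have "\<dots> = V (t n) - V (t 0)" by (rule sum_lessThan_telescope)
  also have "\<dots> \<le> B" using mem[of 0] mem[of n] mono[of n] by (intro B) auto
  finally show "(\<Sum>i<n. \<bar>f (t (Suc i)) - f (t i)\<bar>) \<le> B" .
qed

lemma bv_open_mono:
  assumes "\<And>s t. 0 < s \<Longrightarrow> s \<le> t \<Longrightarrow> t < 1 \<Longrightarrow> f s \<le> f t"
    and "\<And>x. 0 < x \<Longrightarrow> x < 1 \<Longrightarrow> \<bar>f x\<bar> \<le> C"
  shows "bv_open f"
proof (rule bv_open_dominated[where V = f and B = "2 * C"])
  fix s t :: real assume st: "0 < s" "s \<le> t" "t < 1"
  show "\<bar>f t - f s\<bar> \<le> f t - f s" using assms(1)[OF st] by simp
  show "f t - f s \<le> 2 * C" using assms(2)[of s] assms(2)[of t] st by auto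
qed

lemma bv_open_const: "bv_open (\<lambda>_. c)"
  unfolding bv_open_def by auto

lemma bv_open_cong:
  assumes f: "bv_open f" and eq: "\<And>x. 0 < x \<Longrightarrow> x < 1 \<Longrightarrow> h x = f x"
  shows "bv_open h"
proof -
  obtain B where B: "\<And>(n::nat) t. (\<forall>i<n. t i \<le> t (Suc i)) \<and> 0 < t 0 \<and> t n < 1 \<Longrightarrow>
      (\<Sum>i<n. \<bar>f (t (Suc i)) - f (t i)\<bar>) \<le> B" using f unfolding bv_open_def by blast
  show ?thesis unfolding bv_open_def
  proof (intro exI[of _ B] allI impI)
    fix n :: nat and t :: "nat \<Rightarrow> real" assume t: "(\<forall>i<n. t i \<le> t (Suc i)) \<and> 0 < t 0 \<and> t n < 1"
    then have mem: "t i \<in> {0<..<1}" if "i \<le> n" for i using bv_open_partition_mem[of n t i] that by blast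
    have "(\<Sum>i<n. \<bar>h (t (Suc i)) - h (t i)\<bar>) = (\<Sum>i<n. \<bar>f (t (Suc i)) - f (t i)\<bar>)"
    proof (rule sum.cong[OF refl])
      fix i assume "i \<in> {..<n}"
      then show "\<bar>h (t (Suc i)) - h (t i)\<bar> = \<bar>f (t (Suc i)) - f (t i)\<bar>"
        using mem[of i] mem[of "Suc i"] eq[of "t i"] eq[of "t (Suc i)"] by auto
    qed
    then show "(\<Sum>i<n. \<bar>h (t (Suc i)) - h (t i)\<bar>) \<le> B" using B[OF t] by simp
  qed
qed

text \<open>The partition consisting of \<open>x\<close> and \<open>1/2\<close> alone already bounds
  \<open>f x - f (1/2)\<close>.\<close>

lemma bv_open_bounded:
  assumes f: "bv_open f"
  obtains C where "0 \<le> C" "\<And>x. x \<in> {0<..<1} \<Longrightarrow> \<bar>f x\<bar> \<le> C"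
proof -
  obtain B where B: "\<And>(n::nat) t. (\<forall>i<n. t i \<le> t (Suc i)) \<and> 0 < t 0 \<and> t n < 1 \<Longrightarrow>
      (\<Sum>i<n. \<bar>f (t (Suc i)) - f (t i)\<bar>) \<le> B" using f unfolding bv_open_def by blast
  have "\<bar>f x\<bar> \<le> \<bar>f (1/2)\<bar> + \<bar>B\<bar>" if "x \<in> {0<..<1}" for x
    using B[of 1 "\<lambda>i. if i = 0 then x else 1/2"] B[of 1 "\<lambda>i. if i = 0 then 1/2 else x"] that
    by (cases "x \<le> 1/2") auto
  then show ?thesis using that[of "\<bar>f (1/2)\<bar> + \<bar>B\<bar>"] by auto
qed

text \<open>Covers sums, with \<open>C = D = 1\<close>, and products, where sup bounds of the
  factors play the role of \<open>C\<close> and \<open>D\<close>.\<close>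

lemma bv_open_combine:
  assumes f: "bv_open f" and g: "bv_open g" and C: "0 \<le> C" "0 \<le> D"
    and h: "\<And>s t. s \<in> {0<..<1} \<Longrightarrow> t \<in> {0<..<1} \<Longrightarrow> \<bar>h t - h s\<bar> \<le> C * \<bar>f t - f s\<bar> + D * \<bar>g t - g s\<bar>"
  shows "bv_open h"
proof -
  obtain A where A: "\<And>(n::nat) t. (\<forall>i<n. t i \<le> t (Suc i)) \<and> 0 < t 0 \<and> t n < 1 \<Longrightarrow>
      (\<Sum>i<n. \<bar>f (t (Suc i)) - f (t i)\<bar>) \<le> A" using f unfolding bv_open_def by blast
  obtain B where B: "\<And>(n::nat) t. (\<forall>i<n. t i \<le> t (Suc i)) \<and> 0 < t 0 \<and> t n < 1 \<Longrightarrow>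
      (\<Sum>i<n. \<bar>g (t (Suc i)) - g (t i)\<bar>) \<le> B" using g unfolding bv_open_def by blast
  show ?thesis unfolding bv_open_def
  proof (intro exI[of _ "C * A + D * B"] allI impI)
    fix n :: nat and t :: "nat \<Rightarrow> real" assume t: "(\<forall>i<n. t i \<le> t (Suc i)) \<and> 0 < t 0 \<and> t n < 1"
    then have mem: "t i \<in> {0<..<1}" if "i \<le> n" for i using bv_open_partition_mem[of n t i] that by blast
    have "(\<Sum>i<n. \<bar>h (t (Suc i)) - h (t i)\<bar>)
        \<le> (\<Sum>i<n. C * \<bar>f (t (Suc i)) - f (t i)\<bar> + D * \<bar>g (t (Suc i)) - g (t i)\<bar>)"
      by (intro sum_mono h mem) auto
    also have "\<dots> = C * (\<Sum>i<n. \<bar>f (t (Suc i)) - f (t i)\<bar>) + D * (\<Sum>i<n. \<bar>g (t (Suc i)) - g (t i)\<bar>)"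
      by (simp add: sum.distrib sum_distrib_left)
    also have "\<dots> \<le> C * A + D * B" using A[OF t] B[OF t] C by (intro add_mono mult_left_mono) auto
    finally show "(\<Sum>i<n. \<bar>h (t (Suc i)) - h (t i)\<bar>) \<le> C * A + D * B" .
  qed
qed

lemma bv_open_add: "bv_open f \<Longrightarrow> bv_open g \<Longrightarrow> bv_open (\<lambda>x. f x + g x)"
  by (rule bv_open_combine[where f = f and g = g and C = 1 and D = 1]) auto

lemma bv_open_mult:
  assumes f: "bv_open f" and g: "bv_open g"
  shows "bv_open (\<lambda>x. f x * g x)"
proof -
  obtain C where C: "0 \<le> C" "\<And>x. x \<in> {0<..<1} \<Longrightarrow> \<bar>f x\<bar> \<le> C" using bv_open_bounded[OF f] by metis
  obtain D where D: "0 \<le> D" "\<And>x. x \<in> {0<..<1} \<Longrightarrow> \<bar>g x\<bar> \<le> D" using bv_open_bounded[OF g] by metis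
  show ?thesis
  proof (rule bv_open_combine[OF f g D(1) C(1)])
    fix s t :: real assume s: "s \<in> {0<..<1}" and t: "t \<in> {0<..<1}"
    have "\<bar>f t * g t - f s * g s\<bar> = \<bar>g t * (f t - f s) + f s * (g t - g s)\<bar>" by (simp add: algebra_simps)
    also have "\<dots> \<le> \<bar>g t\<bar> * \<bar>f t - f s\<bar> + \<bar>f s\<bar> * \<bar>g t - g s\<bar>"
      by (rule order_trans[OF abs_triangle_ineq]) (simp add: abs_mult)
    also have "\<dots> \<le> D * \<bar>f t - f s\<bar> + C * \<bar>g t - g s\<bar>"
      using C(2)[OF s] D(2)[OF t] by (intro add_mono mult_right_mono) auto
    finally show "\<bar>f t * g t - f s * g s\<bar> \<le> D * \<bar>f t - f s\<bar> + C * \<bar>g t - g s\<bar>" .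
  qed
qed

lemma bv_open_uminus: "bv_open f \<Longrightarrow> bv_open (\<lambda>x. - f x)"
  using bv_open_mult[OF bv_open_const[of "-1"]] by simp

lemma bv_open_primitive:
  assumes F: "primitive_on 0 1 F f"
  shows "bv_open F"
proof -
  have af: "(\<lambda>x. \<bar>f x\<bar>) absolutely_integrable_on {0..1}"
    by (rule set_integrable_abs[OF primitive_onD(1)[OF F]])
  note P = primitive_on_integral[OF af]
  show ?thesis
  proof (rule bv_open_dominated[where V = "\<lambda>x. integral {0..x} (\<lambda>x. \<bar>f x\<bar>)" and B = "integral {0..1} (\<lambda>x. \<bar>f x\<bar>)"])
    fix s t :: real assume st: "0 < s" "s \<le> t" "t < 1"
    have "f absolutely_integrable_on {s..t}"
      using abs_integrable_subinterval[OF primitive_onD(1)[OF F], of s t] st by simp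
    from integral_abs_bound[OF this]
    show "\<bar>F t - F s\<bar> \<le> integral {0..t} (\<lambda>x. \<bar>f x\<bar>) - integral {0..s} (\<lambda>x. \<bar>f x\<bar>)"
      using primitive_onD(2)[OF F, of s t] primitive_onD(2)[OF P, of s t] st by simp
    have af0: "(\<lambda>x. \<bar>f x\<bar>) integrable_on {x..y}" if "0 \<le> x" "y \<le> 1" for x y
      using abs_integrable_subinterval[OF af that] by (simp add: absolutely_integrable_on_def)
    have "integral {0..t} (\<lambda>x. \<bar>f x\<bar>) \<le> integral {0..1} (\<lambda>x. \<bar>f x\<bar>)"
      using st by (intro integral_subset_le af0) auto
    moreover have "0 \<le> integral {0..s} (\<lambda>x. \<bar>f x\<bar>)"
      using st by (intro integral_nonneg af0) auto
    ultimately show "integral {0..t} (\<lambda>x. \<bar>f x\<bar>) - integral {0..s} (\<lambda>x. \<bar>f x\<bar>) \<le> integral {0..1} (\<lambda>x. \<bar>f x\<bar>)"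
      by simp
  qed
qed

text \<open>The majorant for a blow-up at both ends; the second summand is the first one under the
  reflection of x to 1 - x.\<close>

lemma integrable_powr_ends:
  fixes e :: real
  assumes "-1 < e"
  shows "integrable (lebesgue_on {0..1}) (\<lambda>x. x powr e + (1 - x) powr e)"
proof -
  have h0: "((\<lambda>x. x powr e) has_integral (1 powr (e+1) / (e+1))) (cbox 0 1)"
    using has_integral_powr_from_0[of e 1] assms by simp
  have "((\<lambda>x. ((-1) *\<^sub>R x + 1) powr e) has_integral ((1 / \<bar>-1\<bar> ^ DIM(real)) *\<^sub>R (1 powr (e+1) / (e+1))))
     ((\<lambda>x. (1 / (-1)) *\<^sub>R x + - ((1 / (-1)) *\<^sub>R 1)) ` cbox 0 (1::real))"
    by (rule has_integral_affinity[OF h0]) simp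
  moreover have "(\<lambda>x::real. (1 / (-1)) *\<^sub>R x + - ((1 / (-1)) *\<^sub>R 1)) ` cbox 0 1 = {0..1}"
    by (auto simp: image_iff intro!: bexI[of _ "1 - _"])
  ultimately have "(\<lambda>x. (1 - x) powr e) integrable_on {0..1}"
    by (auto simp: integrable_on_def)
  moreover have "(\<lambda>x. x powr e) integrable_on {0..1}" using h0 by (auto simp: integrable_on_def)
  ultimately have "(\<lambda>x. x powr e + (1 - x) powr e) integrable_on {0..1}"
    by (intro integrable_add)
  then have "(\<lambda>x. x powr e + (1 - x) powr e) absolutely_integrable_on {0..1}"
    by (intro nonnegative_absolutely_integrable_1) auto
  then show ?thesis by (simp add: abs_integrable_lebesgue_on)
qed

section \<open>Formula and integrability of the third derivative\<close>

context critical_point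
begin

text \<open>The formal derivative of \<open>u2\<close> by the product and chain rule. Where
  \<open>K\<close> vanishes, \<open>powr\<close> returns 0 for any exponent, so \<open>u3\<close> is
  0 at both ends.\<close>

definition u3 :: "real \<Rightarrow> real" where
  "u3 x = - (b x * (\<alpha> * (K x / p) powr (\<alpha> - 1) / p * k x) + (K x / p) powr \<alpha> * (b' x * u2 x))"

lemma k_measurable[measurable]: "k \<in> borel_measurable (lebesgue_on {0..1})"
  using k_integrable by (simp add: abs_integrable_lebesgue_on)

lemma u3_measurable[measurable]: "u3 \<in> borel_measurable (lebesgue_on {0..1})"
proof -
  note [measurable] = cont_b[THEN measurable_continuous_lebesgue] cont_b'[THEN measurable_continuous_lebesgue]
    cont_u2[THEN measurable_continuous_lebesgue] cont_K[THEN measurable_continuous_lebesgue]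
  show ?thesis unfolding u3_def by measurable
qed

lemma k_bounded: obtains C where "0 \<le> C" "\<And>x. x \<in> {0..1} \<Longrightarrow> \<bar>k x\<bar> \<le> C"
proof -
  obtain C where C: "C > 0" "\<And>x. x \<in> {0..1} \<Longrightarrow> \<bar>b x\<bar> \<le> C" using continuous_abs_bound[OF cont_b] by metis
  have "\<bar>k x\<bar> \<le> m 0 * C" if x: "x \<in> {0..1}" for x
  proof -
    have "\<bar>m x - c\<bar> \<le> m 0" using m_nonneg[of x] m_antimono[of 0 x] c_bounds x by auto
    then show ?thesis unfolding k_def abs_mult using C(2)[OF x] m0_pos by (intro mult_mono) auto
  qed
  then show ?thesis using that[of "m 0 * C"] C m0_pos by simp
qed

lemma K_bounded: obtains C where "0 < C" "\<And>x. x \<in> {0..1} \<Longrightarrow> K x / p \<le> C"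
proof -
  have "continuous_on {0..1} (\<lambda>x. K x / p)" using p by (intro continuous_intros cont_K) auto
  from continuous_abs_bound[OF this]
  obtain C where "C > 0" "\<And>x. x \<in> {0..1} \<Longrightarrow> \<bar>K x / p\<bar> \<le> C" by metis
  then show ?thesis using that[of C] by (meson abs_ge_self order_trans)
qed

text \<open>Isolates the one factor that can be unbounded; \<open>k\<close> is bounded although it
  may jump, and all other factors are continuous.\<close>

lemma u3_bound:
  obtains C D where "0 \<le> C" "0 \<le> D" "\<And>x. x \<in> {0..1} \<Longrightarrow> \<bar>u3 x\<bar> \<le> C * (K x / p) powr (\<alpha> - 1) + D"
proof -
  obtain C1 where C1: "C1 > 0" "\<And>x. x \<in> {0..1} \<Longrightarrow> \<bar>b x * (\<alpha> / p)\<bar> \<le> C1"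
    using continuous_abs_bound[OF continuous_on_mult_right[OF cont_b]] by metis
  obtain C2 where C2: "C2 \<ge> 0" "\<And>x. x \<in> {0..1} \<Longrightarrow> \<bar>k x\<bar> \<le> C2" using k_bounded by metis
  have "continuous_on {0..1} (\<lambda>x. (K x / p) powr \<alpha> * (b' x * u2 x))"
    using p \<alpha>_pos K_nonneg by (intro continuous_intros cont_K cont_b' cont_u2 continuous_on_powr') auto
  from continuous_abs_bound[OF this]
  obtain D where D: "D > 0" "\<And>x. x \<in> {0..1} \<Longrightarrow> \<bar>(K x / p) powr \<alpha> * (b' x * u2 x)\<bar> \<le> D" by metis
  show ?thesis
  proof (rule that[of "C1 * C2" D])
    fix x :: real assume x: "x \<in> {0..1}"
    define X Y where "X = b x * (\<alpha> / p) * k x * (K x / p) powr (\<alpha> - 1)"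
      and "Y = (K x / p) powr \<alpha> * (b' x * u2 x)"
    have "u3 x = - (X + Y)" by (simp add: u3_def X_def Y_def)
    then have "\<bar>u3 x\<bar> \<le> \<bar>X\<bar> + \<bar>Y\<bar>" by linarith
    also have "\<dots> = \<bar>b x * (\<alpha> / p)\<bar> * \<bar>k x\<bar> * (K x / p) powr (\<alpha> - 1) + \<bar>(K x / p) powr \<alpha> * (b' x * u2 x)\<bar>"
      by (simp add: X_def Y_def abs_mult)
    also have "\<dots> \<le> C1 * C2 * (K x / p) powr (\<alpha> - 1) + D"
      using C1(1) C1(2)[OF x] C2(1) C2(2)[OF x] D(2)[OF x]
      by (intro add_mono mult_mono) auto
    finally show "\<bar>u3 x\<bar> \<le> C1 * C2 * (K x / p) powr (\<alpha> - 1) + D" .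
  qed (use C1 C2 D in auto)
qed

text \<open>Inside the interval \<open>K > 0\<close> keeps \<open>powr\<close> smooth, and
  \<open>primitive_on_open\<close> reaches the ends. Integrability of \<open>u3\<close> is assumed
  because its proof differs for p <= 2 and p > 2.\<close>

lemma primitive_u2:
  assumes int: "integrable (lebesgue_on {0..1}) u3"
  shows "primitive_on 0 1 u2 u3"
proof (rule primitive_on_open)
  show "u3 absolutely_integrable_on {0..1}" using int by (simp add: abs_integrable_lebesgue_on)
  fix s t :: real assume st: "0 < s" "s \<le> t" "t < 1"
  have Kim: "y > 0" if "y \<in> K ` {s..t}" for y using that st by (auto intro!: K_pos)
  have "primitive_on s t (\<lambda>x. (K x / p) powr \<alpha>) (\<lambda>x. (\<alpha> * (K x / p) powr (\<alpha> - 1) / p) * k x)"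
  proof (rule primitive_on_chain[where H = "\<lambda>y. (y / p) powr \<alpha>" and H' = "\<lambda>y. \<alpha> * (y / p) powr (\<alpha> - 1) / p"])
    show "primitive_on s t K k" by (rule primitive_on_subinterval[OF primitive_K]) (use st in auto)
    show "((\<lambda>y. (y / p) powr \<alpha>) has_real_derivative \<alpha> * (y / p) powr (\<alpha> - 1) / p) (at y)"
      if "y \<in> K ` {s..t}" for y
      using Kim[OF that] p by (auto intro!: derivative_eq_intros simp: field_simps)
    show "continuous_on (K ` {s..t}) (\<lambda>y. \<alpha> * (y / p) powr (\<alpha> - 1) / p)"
      using Kim p by (intro continuous_intros) (auto simp: less_le)
  qed
  moreover have "primitive_on s t b (\<lambda>x. b' x * u2 x)"
    by (rule primitive_on_subinterval[OF primitive_b_u2]) (use st in auto)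
  ultimately have "primitive_on s t (\<lambda>x. (K x / p) powr \<alpha> * b x)
     (\<lambda>x. b x * (\<alpha> * (K x / p) powr (\<alpha> - 1) / p * k x) + (K x / p) powr \<alpha> * (b' x * u2 x))"
    by (rule primitive_on_mult)
  from primitive_onD(2)[OF this, of s t]
  have "u2 t - u2 s = - integral {s..t} (\<lambda>x. b x * (\<alpha> * (K x / p) powr (\<alpha> - 1) / p * k x)
      + (K x / p) powr \<alpha> * (b' x * u2 x))"
    using st by (subst (1 2) u2_def) simp
  then show "u2 t - u2 s = integral {s..t} u3"
    unfolding u3_def by (simp only: Henstock_Kurzweil_Integration.integral_neg)
qed (use cont_u2 in auto)

lemma sob_chain_u:
  assumes int: "integrable (lebesgue_on {0..1}) u3"
  shows "sob_chain 3 u (\<lambda>j. if j = 0 then u else if j = 1 then g else if j = 2 then u2 else u3)"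
  unfolding sob_chain_iff
  using u_g primitive_g_u2 primitive_u2[OF int] by (auto simp: less_Suc_eq numeral_3_eq_3)

lemma sobolev_u:
  assumes int: "integrable (lebesgue_on {0..1}) u3"
    and X: "\<And>f. continuous_on {0..1} f \<Longrightarrow> X f" and X3: "X u3"
  shows "sobolev 3 X u"
  unfolding sobolev_def
  by (rule exI, rule conjI[OF sob_chain_u[OF int]]) (use X[OF cont_u] X[OF cont_g] X[OF cont_u2] X3 in simp)

lemma u3_bounded:
  assumes "p \<le> 2"
  obtains C where "\<And>x. x \<in> {0..1} \<Longrightarrow> \<bar>u3 x\<bar> \<le> C"
proof -
  obtain C D where CD: "0 \<le> C" "0 \<le> D" "\<And>x. x \<in> {0..1} \<Longrightarrow> \<bar>u3 x\<bar> \<le> C * (K x / p) powr (\<alpha> - 1) + D"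
    using u3_bound by metis
  obtain M where M: "0 < M" "\<And>x. x \<in> {0..1} \<Longrightarrow> K x / p \<le> M" using K_bounded by metis
  have \<alpha>1: "0 \<le> \<alpha> - 1" using assms p by (simp add: \<alpha>_def field_simps)
  have "\<bar>u3 x\<bar> \<le> C * M powr (\<alpha> - 1) + D" if x: "x \<in> {0..1}" for x
  proof -
    have "(K x / p) powr (\<alpha> - 1) \<le> M powr (\<alpha> - 1)"
      using M(2)[OF x] K_nonneg[OF x] p \<alpha>1 by (intro powr_mono2) auto
    then have "C * (K x / p) powr (\<alpha> - 1) \<le> C * M powr (\<alpha> - 1)" using CD(1) by (rule mult_left_mono)
    then show ?thesis using CD(3)[OF x] by linarith
  qed
  then show ?thesis by (rule that)
qed

lemma u3_integrable_le2: assumes "p \<le> 2" shows "integrable (lebesgue_on {0..1}) u3"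
proof -
  obtain C where C: "\<And>x. x \<in> {0..1} \<Longrightarrow> \<bar>u3 x\<bar> \<le> C" using u3_bounded[OF assms] by metis
  show ?thesis
    by (rule integrable_bound_lebesgue[of _ _ "\<lambda>_. C"]) (use C in auto)
qed

lemma W3_inf: assumes "p \<le> 2" shows "sobolev 3 Linf_on u"
proof (rule sobolev_u[OF u3_integrable_le2[OF assms] Linf_on_continuous])
  obtain C where C: "\<And>x. x \<in> {0..1} \<Longrightarrow> \<bar>u3 x\<bar> \<le> C" using u3_bounded[OF assms] by metis
  then show "Linf_on u3" unfolding Linf_on_def by (auto intro!: exI[of _ C])
qed

text \<open>\<open>K\<close> rises up to \<open>z\<close> and falls afterwards. Writing f for the
  power, f x = f (min x z) + f (max x z) - f z is a sum of monotone functions.\<close>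

lemma bv_K_powr:
  assumes e: "0 \<le> e"
  shows "bv_open (\<lambda>x. (K x / p) powr e)"
proof -
  let ?f = "\<lambda>x. (K x / p) powr e"
  obtain z where z: "0 < z" "z < 1"
    "\<And>s t. 0 \<le> s \<Longrightarrow> s \<le> t \<Longrightarrow> t \<le> z \<Longrightarrow> K s \<le> K t"
    "\<And>s t. z \<le> s \<Longrightarrow> s \<le> t \<Longrightarrow> t \<le> 1 \<Longrightarrow> K t \<le> K s" using K_unimodal by metis
  obtain M where M: "0 < M" "\<And>x. x \<in> {0..1} \<Longrightarrow> K x / p \<le> M" using K_bounded by metis
  have fle: "?f x \<le> ?f y" if "K x \<le> K y" "x \<in> {0..1}" for x y
    using that K_nonneg[of x] e p by (intro powr_mono2) (auto simp: divide_right_mono)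
  have fM: "\<bar>?f x\<bar> \<le> M powr e" if "x \<in> {0..1}" for x
    using M(2)[OF that] K_nonneg[OF that] e p by (simp add: powr_mono2)
  have "bv_open (\<lambda>x. ?f (min x z))"
    using z fM by (intro bv_open_mono[of _ "M powr e"] fle) auto
  moreover have "bv_open (\<lambda>x. - (- ?f (max x z)))"
    by (intro bv_open_uminus bv_open_mono[of _ "M powr e"]) (use z fM in \<open>auto intro!: fle\<close>)
  ultimately have "bv_open (\<lambda>x. ?f (min x z) + - (- ?f (max x z)) + - ?f z)"
    by (intro bv_open_add bv_open_const)
  then show ?thesis by (rule bv_open_cong) (auto simp: min_def max_def)
qed

text \<open>\<open>u3\<close> is built by sums and products from functions of bounded variation:
  \<open>k\<close> because \<open>m\<close> is monotone, the other factors via primitives, powers of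
  \<open>K\<close> and constants.\<close>

lemma W3_BV: assumes p2: "p \<le> 2" shows "third_deriv_BV u"
proof -
  have \<alpha>1: "0 \<le> \<alpha> - 1" using assms p by (simp add: \<alpha>_def field_simps)
  have bvb: "bv_open b" by (rule bv_open_primitive[OF primitive_b_u2])
  have bvu2: "bv_open u2" by (rule bv_open_primitive[OF primitive_u2[OF u3_integrable_le2[OF p2]]])
  have bvm: "bv_open (\<lambda>x. - (- m x))"
    by (intro bv_open_uminus bv_open_mono[of _ "m 0"]) (use m_nonneg m_antimono in auto)
  have bvk: "bv_open k"
    using bv_open_mult[OF bv_open_add[OF bvm bv_open_const[of "- c"]] bvb] by (simp add: k_def[abs_def])
  \<comment> \<open>\<open>b'\<close> contains the second derivative of \<open>G\<close> along
    \<open>g\<close>; its bounded variation uses one more derivative of \<open>G\<close>.\<close>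
  have "primitive_on 0 1 (\<lambda>x. deriv (deriv G) (g x)) (\<lambda>x. deriv (deriv (deriv G)) (g x) * u2 x)"
  proof (rule primitive_on_chain[OF primitive_g_u2])
    show "(deriv (deriv G) has_real_derivative deriv (deriv (deriv G)) y) (at y)" for y
      by (rule standing_G_derivatives(2)[OF G])
    have "((deriv ^^ 3) G) differentiable (at x)" for x using G by (simp add: standing_G_def)
    then have "isCont (deriv (deriv (deriv G))) x" for x
      by (auto simp: numeral_3_eq_3 intro!: differentiable_imp_continuous_within)
    then show "continuous_on (g ` {0..1}) (deriv (deriv (deriv G)))"
      by (simp add: continuous_at_imp_continuous_on)
  qed
  then have "bv_open (\<lambda>x. deriv (deriv G) (g x))" by (rule bv_open_primitive)
  then have bvb': "bv_open b'" unfolding b'_def[abs_def] power2_eq_square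
    by (intro bv_open_uminus bv_open_mult bvb)
  have "bv_open (\<lambda>x. - (b x * (\<alpha> * (K x / p) powr (\<alpha> - 1) * (1 / p) * k x) + (K x / p) powr \<alpha> * (b' x * u2 x)))"
    using \<alpha>1 by (intro bv_open_uminus bv_open_add bv_open_mult bv_open_const bvb bvk bvb' bvu2 bv_K_powr) auto
  then have "bv_open u3" by (simp add: u3_def[abs_def])
  then show ?thesis unfolding third_deriv_BV_def
    using sob_chain_u[OF u3_integrable_le2[OF p2]] by fastforce
qed

text \<open>Since \<open>\<alpha> - 1 < 0\<close>, the linear lower bound on \<open>K\<close>
  becomes an upper bound on the singular factor, and the condition on \<open>q\<close> says that the
  exponent \<open>(\<alpha> - 1) * q\<close> exceeds -1.\<close>

lemma u3_Lq:
  assumes p2: "2 < p" and q: "1 \<le> q" "q < (p - 1) / (p - 2)"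
  shows "Lp_on q u3"
proof -
  define e where "e = \<alpha> - 1"
  have e: "e < 0" "-1 < e * q"
    using p2 q by (auto simp: e_def \<alpha>_def field_simps)
  obtain C D where CD: "0 \<le> C" "0 \<le> D" "\<And>x. x \<in> {0..1} \<Longrightarrow> \<bar>u3 x\<bar> \<le> C * (K x / p) powr e + D"
    using u3_bound unfolding e_def by metis
  obtain M where M: "0 < M" "\<And>x. x \<in> {0..1} \<Longrightarrow> K x / p \<le> M" using K_bounded by metis
  obtain z \<kappa> where z: "\<kappa> > 0" "\<And>x. 0 \<le> x \<Longrightarrow> x \<le> z \<Longrightarrow> \<kappa> * x \<le> K x"
    "\<And>x. z \<le> x \<Longrightarrow> x \<le> 1 \<Longrightarrow> \<kappa> * (1 - x) \<le> K x" using K_unimodal by metis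
  \<comment> \<open>\<open>D\<close> is absorbed into the singular term: \<open>K x / p <= M\<close>
    and \<open>e < 0\<close> give \<open>(K x / p) powr e >= M powr e\<close>.\<close>
  define E where "E = (C + D / M powr e) * (\<kappa> / p) powr e"
  have E: "0 \<le> E" using CD by (simp add: E_def)
  have key: "\<bar>u3 x\<bar> powr q \<le> E powr q * (x powr (e * q) + (1 - x) powr (e * q))" if x: "x \<in> {0..1}" for x
  proof (cases "x = 0 \<or> x = 1")
    case True
    then have "u3 x = 0" by (auto simp: u3_def K_ends)
    then show ?thesis using q by simp
  next
    case False
    then have xi: "0 < x" "x < 1" using x by auto
    \<comment> \<open>The distance to the end on the same side of \<open>z\<close>, where the linear
      lower bound holds; this is not always the nearer end.\<close>
    define y where "y = (if x \<le> z then x else 1 - x)"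
    have y: "0 < y" "\<kappa> * y \<le> K x" using xi z by (auto simp: y_def)
    have Kp: "0 < K x / p" using K_pos[of x] xi p by auto
    have "D \<le> D / M powr e * (K x / p) powr e"
    proof -
      have "M powr e \<le> (K x / p) powr e" using Kp M(2)[OF x] e by (intro powr_mono2') auto
      then have "D / M powr e * M powr e \<le> D / M powr e * (K x / p) powr e"
        using CD by (intro mult_left_mono) auto
      then show ?thesis using M(1) by simp
    qed
    then have "\<bar>u3 x\<bar> \<le> (C + D / M powr e) * (K x / p) powr e"
      using CD(3)[OF x] by (simp add: distrib_right)
    also have "(K x / p) powr e \<le> (\<kappa> / p * y) powr e"
      using y z(1) p e by (intro powr_mono2') (auto simp: field_simps)
    also have "(\<kappa> / p * y) powr e = (\<kappa> / p) powr e * y powr e"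
      by (rule powr_mult)
    finally have "\<bar>u3 x\<bar> \<le> E * y powr e"
      using CD by (simp add: E_def mult_left_mono mult.assoc)
    then have "\<bar>u3 x\<bar> powr q \<le> (E * y powr e) powr q" using q by (intro powr_mono2) auto
    also have "\<dots> = E powr q * y powr (e * q)" by (simp add: powr_mult powr_powr)
    also have "\<dots> \<le> E powr q * (x powr (e * q) + (1 - x) powr (e * q))"
      by (intro mult_left_mono) (auto simp: y_def)
    finally show ?thesis .
  qed
  have "integrable (lebesgue_on {0..1}) (\<lambda>x. E powr q * (x powr (e * q) + (1 - x) powr (e * q)))"
    using integrable_powr_ends[OF e(2)] by (intro integrable_mult_right)
  then have "integrable (lebesgue_on {0..1}) (\<lambda>x. \<bar>u3 x\<bar> powr q)"
    by (rule integrable_bound_lebesgue) (use key in auto)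
  then show ?thesis by (simp add: Lp_on_def)
qed

lemma W3_q:
  assumes p2: "2 < p" and q: "1 \<le> q" "q < (p - 1) / (p - 2)"
  shows "sobolev 3 (Lp_on q) u"
proof (rule sobolev_u)
  have "Lp_on 1 u3" using p2 by (intro u3_Lq) (auto simp: field_simps)
  then have "integrable (lebesgue_on {0..1}) (\<lambda>x. \<bar>u3 x\<bar>)" by (simp add: Lp_on_def)
  then show "integrable (lebesgue_on {0..1}) u3" by (rule integrable_bound_lebesgue) auto
qed (use q in \<open>auto intro: u3_Lq[OF p2] Lp_on_continuous\<close>)

text \<open>A negative Sobolev statement concerns every chain, so the continuous representatives
  must be unique: differentiation identifies them inside the interval, and continuity carries this
  to the ends.\<close>

lemma sob_chain_second:
  assumes D: "sob_chain 3 u D" and x: "x \<in> {0..1}"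
  shows "D 2 x = u2 x"
proof -
  have D0: "D 0 y = u y" if "y \<in> {0..1}" for y using D that by (simp add: sob_chain_iff)
  have P0: "primitive_on 0 1 (D 0) (D 1)" and P1: "primitive_on 0 1 (D 1) (D 2)" and P2: "primitive_on 0 1 (D 2) (D 3)"
    using D by (auto simp: sob_chain_iff numeral_2_eq_2 numeral_3_eq_3)
  note c1 = primitive_on_continuous[OF P1] and c2 = primitive_on_continuous[OF P2]
  have u1: "D 1 y = g y" if y: "y \<in> {0<..<1}" for y
  proof -
    have "deriv u y = D 1 y"
      by (rule deriv_eq_on_open[OF primitive_on_derivative[OF P0 c1] y]) (use y D0 in auto)
    then show ?thesis using deriv_u[OF y] by simp
  qed
  have u2: "D 2 y - u2 y = 0" if y: "y \<in> {0<..<1}" for y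
  proof -
    have "deriv g y = D 2 y"
      by (rule deriv_eq_on_open[OF primitive_on_derivative[OF P1 c2] y]) (use y u1 in auto)
    then show ?thesis using primitive_on_derivative_open[OF primitive_g_u2 cont_u2 y] by simp
  qed
  have "D 2 x - u2 x = 0"
  proof (rule continuous_constant_on_closure[of "{0<..<1}" "\<lambda>x. D 2 x - u2 x"])
    show "continuous_on (closure {0<..<1}) (\<lambda>x. D 2 x - u2 x)"
      by (auto intro!: continuous_intros c2 cont_u2)
  qed (use u2 x in auto)
  then show ?thesis by simp
qed

text \<open>A third derivative in L^r with \<open>r = (p - 1) / (p - 2)\<close> and
  \<open>u2 0 = 0\<close> would make \<open>u2 x\<close> of smaller order than
  \<open>x powr (1 - 1 / r)\<close> at 0. But \<open>1 - 1 / r = \<alpha>\<close>, and the linear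
  lower bound on \<open>K\<close> keeps \<open>\<bar>u2 x\<bar>\<close> above a multiple of
  \<open>x powr \<alpha>\<close>.\<close>

lemma not_W3_r:
  assumes p2: "2 < p"
  shows "\<not> sobolev 3 (Lp_on ((p - 1) / (p - 2))) u"
proof
  define r where "r = (p - 1) / (p - 2)"
  have r: "r > 1" "1 - 1 / r = \<alpha>" using p2 by (auto simp: r_def \<alpha>_def field_simps)
  assume "sobolev 3 (Lp_on ((p - 1) / (p - 2))) u"
  then obtain D where D: "sob_chain 3 u D" "Lp_on r (D 3)" unfolding sobolev_def r_def by auto
  define h where "h = D 3"
  have P: "primitive_on 0 1 (D 2) h"
    using D(1) by (auto simp: sob_chain_iff numeral_2_eq_2 numeral_3_eq_3 h_def)
  have hi: "h absolutely_integrable_on {0..1}" by (rule primitive_onD[OF P])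
  have hr: "(\<lambda>x. \<bar>h x\<bar> powr r) absolutely_integrable_on {0..1}"
    using D(2) by (simp add: abs_integrable_lebesgue_on Lp_on_def h_def)
  define I where "I x = integral {0..x} (\<lambda>x. \<bar>h x\<bar> powr r)" for x
  have PI: "primitive_on 0 1 I (\<lambda>x. \<bar>h x\<bar> powr r)" unfolding I_def by (rule primitive_on_integral[OF hr])
  obtain z \<kappa> where z: "0 < z" "z < 1" "\<kappa> > 0" "\<And>x. 0 \<le> x \<Longrightarrow> x \<le> z \<Longrightarrow> \<kappa> * x \<le> K x" using K_unimodal by metis
  obtain \<beta> where \<beta>: "\<beta> > 0" "\<And>x. x \<in> {0..1} \<Longrightarrow> \<beta> \<le> b x" using b_lower by metis
  \<comment> \<open>A third of the constant in the lower bound: the two terms of the upper bound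
    will each cost at most one \<open>\<epsilon>\<close>.\<close>
  define \<epsilon> where "\<epsilon> = (\<kappa> / p) powr \<alpha> * \<beta> / 3"
  have \<epsilon>: "\<epsilon> > 0" using z(3) \<beta>(1) p by (simp add: \<epsilon>_def)
  have lower: "3 * \<epsilon> * x powr \<alpha> \<le> \<bar>u2 x\<bar>" if x: "0 \<le> x" "x \<le> z" for x
  proof -
    have "(\<kappa> / p * x) powr \<alpha> \<le> (K x / p) powr \<alpha>"
      using z(3) z(4)[OF x] x p \<alpha>_pos by (intro powr_mono2) (auto simp: field_simps)
    then have "(\<kappa> / p) powr \<alpha> * x powr \<alpha> * \<beta> \<le> (K x / p) powr \<alpha> * b x"
      using \<beta>(1) \<beta>(2)[of x] x z(2) unfolding powr_mult by (intro mult_mono) auto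
    then show ?thesis using b_pos[of x] by (simp add: u2_def \<epsilon>_def abs_mult mult_ac)
  qed
  (* Weighted Young inequality h <= tau + tau^(1-r) h^r with tau = eps x^(-1/r). *)
  have upper: "\<bar>u2 x\<bar> \<le> x powr \<alpha> * (\<epsilon> + \<epsilon> powr (1 - r) * I x)" if x: "0 < x" "x \<le> 1" for x
  proof -
    define \<tau> where "\<tau> = \<epsilon> * x powr (- (1 / r))"
    have \<tau>: "\<tau> > 0" using \<epsilon> x by (simp add: \<tau>_def)
    have pt: "\<bar>h y\<bar> \<le> \<tau> + \<tau> powr (1 - r) * \<bar>h y\<bar> powr r" for y
    proof (cases "\<bar>h y\<bar> \<le> \<tau>")
      case False
      then have "\<bar>h y\<bar> powr (1 - r) \<le> \<tau> powr (1 - r)" using \<tau> r by (intro powr_mono2') auto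
      then have "\<bar>h y\<bar> powr (1 - r) * \<bar>h y\<bar> powr r \<le> \<tau> powr (1 - r) * \<bar>h y\<bar> powr r"
        by (intro mult_right_mono) auto
      moreover have "\<bar>h y\<bar> powr (1 - r) * \<bar>h y\<bar> powr r = \<bar>h y\<bar>"
        using False \<tau> by (simp add: powr_add[symmetric])
      ultimately show ?thesis using \<tau> by simp
    qed (simp add: add_increasing2)
    have hi': "h absolutely_integrable_on {0..x}" and hr': "(\<lambda>x. \<bar>h x\<bar> powr r) integrable_on {0..x}"
      using abs_integrable_subinterval[OF hi, of 0 x] abs_integrable_subinterval[OF hr, of 0 x] x
      by (auto simp: absolutely_integrable_on_def)
    have "u2 x = integral {0..x} h"
      using primitive_onD(2)[OF P, of 0 x] sob_chain_second[OF D(1), of 0] sob_chain_second[OF D(1), of x] x u2_ends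
      by auto
    then have "\<bar>u2 x\<bar> \<le> integral {0..x} (\<lambda>y. \<bar>h y\<bar>)" using integral_abs_bound[OF hi'] by simp
    also have "\<dots> \<le> integral {0..x} (\<lambda>y. \<tau> + \<tau> powr (1 - r) * \<bar>h y\<bar> powr r)"
      using hi' hr' by (intro integral_le pt integrable_add integrable_on_mult_right)
        (auto simp: absolutely_integrable_on_def)
    also have "\<dots> = \<tau> * x + \<tau> powr (1 - r) * I x"
      using hr' x by (subst Henstock_Kurzweil_Integration.integral_add) (auto simp: I_def intro!: integrable_on_mult_right)
    also have "\<tau> * x = \<epsilon> * x powr \<alpha>"
      using x r(2) powr_add[of x "- (1 / r)" 1] by (simp add: \<tau>_def)
    also have "\<tau> powr (1 - r) = \<epsilon> powr (1 - r) * x powr \<alpha>"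
    proof -
      have "- (1 / r) * (1 - r) = \<alpha>" using r by (simp add: field_simps)
      then show ?thesis using \<epsilon> x by (simp add: \<tau>_def powr_mult powr_powr)
    qed
    finally show ?thesis by (simp add: algebra_simps)
  qed
  \<comment> \<open>Here the smaller order arises: \<open>I\<close> is continuous with
    \<open>I 0 = 0\<close>, so the second term drops below \<open>\<epsilon>\<close> near 0.\<close>
  have "\<exists>d>0. \<forall>x\<in>{0..1}. dist x 0 < d \<longrightarrow> dist (I x) (I 0) < \<epsilon> / \<epsilon> powr (1 - r)"
    using primitive_on_continuous[OF PI] \<epsilon> unfolding continuous_on_iff by (auto elim!: ballE[of _ _ 0])
  then obtain d where d: "d > 0" "\<And>x. x \<in> {0..1} \<Longrightarrow> \<bar>x\<bar> < d \<Longrightarrow> \<bar>I x\<bar> < \<epsilon> / \<epsilon> powr (1 - r)"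
    by (auto simp: dist_real_def I_def)
  define x where "x = min z (d / 2)"
  have x: "0 < x" "x \<le> z" "x \<le> 1" "x < d" using z d by (auto simp: x_def min_def)
  have "\<epsilon> powr (1 - r) * I x < \<epsilon>" using d(2)[of x] x \<epsilon> by (simp add: field_simps abs_less_iff)
  then have "x powr \<alpha> * (\<epsilon> + \<epsilon> powr (1 - r) * I x) < x powr \<alpha> * (3 * \<epsilon>)"
    using x \<epsilon> by (intro mult_strict_left_mono) auto
  moreover have "x powr \<alpha> * (3 * \<epsilon>) \<le> \<bar>u2 x\<bar>" using lower[of x] x by (simp add: mult.commute)
  ultimately show False using upper[of x] x by linarith
qed

end

section \<open>The tent obstacle\<close>

context critical_point
begin

text \<open>At a contact point the rest of the tent lies strictly below the tangent of
  \<open>u\<close>. Off the tip, such a point is interior to a straight side, and the two ends of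
  that side force its slope to be both above and below \<open>g x\<close>.\<close>

lemma tent_contact:
  assumes tent: "\<And>x. \<psi> x = 1/4 - \<bar>x - 1/2\<bar>" and x: "x \<in> {0..1}" "x \<noteq> 1/2"
  shows "u x \<noteq> \<psi> x"
proof
  assume eq: "u x = \<psi> x"
  have x01: "x \<noteq> 0" "x \<noteq> 1" using eq u_ends by (auto simp: tent)
  have ub: "\<psi> y < \<psi> x + g x * (y - x)" if "y \<in> {0..1}" "y \<noteq> x" for y
    using u_below_tangent[OF x(1) that(1)] u_\<psi>[OF that(1)] that eq by auto
  show False
  proof (cases "x < 1/2")
    case True
    have "(g x - 1) * x < 0" using ub[of 0] x True x01 by (simp add: tent algebra_simps)
    moreover have "0 < (g x - 1) * (1/2 - x)" using ub[of "1/2"] x True by (simp add: tent field_simps)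
    ultimately show False using True x x01 by (auto simp: mult_less_0_iff zero_less_mult_iff)
  next
    case False
    have "(g x + 1) * (x - 1/2) < 0" using ub[of "1/2"] x False by (simp add: tent field_simps)
    moreover have "0 < (g x + 1) * (1 - x)" using ub[of 1] x False x01 by (simp add: tent algebra_simps)
    ultimately show False using False x x01 by (auto simp: mult_less_0_iff zero_less_mult_iff)
  qed
qed

text \<open>All mass sits at 1/2, so \<open>k\<close> is at least \<open>\<gamma> > 0\<close> to the
  left and negative to the right. A derivative would have to be both at least
  \<open>\<gamma>\<close> and at most 0.\<close>

lemma K_kink:
  assumes contact: "\<And>x. x \<in> {0..1} \<Longrightarrow> x \<noteq> 1/2 \<Longrightarrow> u x \<noteq> \<psi> x"
  shows "\<not> (K has_real_derivative L) (at (1/2))"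
proof
  assume D: "(K has_real_derivative L) (at (1/2))"
  have m1: "m y = m 0" if "0 \<le> y" "y \<le> 1/2" for y
    using m_eq_if_no_contact[of 0 y] contact that by auto
  have m2: "m y = 0" if "1/2 < y" "y \<le> 1" for y
    using m_zero_if_no_contact[of y] contact that by auto
  obtain \<beta> where \<beta>: "\<beta> > 0" "\<And>x. x \<in> {0..1} \<Longrightarrow> \<beta> \<le> b x" using b_lower by metis
  define \<gamma> where "\<gamma> = (m 0 - c) * \<beta>"
  have \<gamma>: "\<gamma> > 0" using c_bounds \<beta> by (simp add: \<gamma>_def)
  have left: "\<gamma> * h \<le> K (1/2) - K (1/2 - h)" if h: "0 < h" "h < 1/2" for h
  proof -
    have "\<gamma> * (1/2 - (1/2 - h)) \<le> K (1/2) - K (1/2 - h)"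
    proof (rule K_diff_ge)
      fix x assume x: "1/2 - h < x" "x < 1/2"
      then show "\<gamma> \<le> k x" unfolding \<gamma>_def k_def
        using m1[of x] h c_bounds \<beta>(1) \<beta>(2)[of x] by (intro mult_mono) auto
    qed (use h in auto)
    then show ?thesis by simp
  qed
  have right: "K (1/2 + h) \<le> K (1/2)" if h: "0 < h" "h < 1/2" for h
  proof -
    have "K (1/2 + h) - K (1/2) \<le> 0 * (1/2 + h - 1/2)"
    proof (rule K_diff_le)
      fix x assume x: "1/2 < x" "x < 1/2 + h"
      then show "k x \<le> 0" unfolding k_def
        using m2[of x] h c_bounds b_pos[of x] by (intro mult_nonpos_nonneg) auto
    qed (use h in auto)
    then show ?thesis by simp
  qed
  show False
  proof (cases "L > 0")
    case True
    then obtain d where d: "d > 0" "\<And>h. 0 < h \<Longrightarrow> h < d \<Longrightarrow> K (1/2) < K (1/2 + h)"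
      using DERIV_pos_inc_right[OF D] by blast
    define h where "h = min d (1/2) / 2"
    have "0 < h" "h < d" "h < 1/2" using d(1) by (auto simp: h_def min_def)
    then show False using d(2)[of h] right[of h] by simp
  next
    case False
    \<comment> \<open>Subtracting \<open>\<gamma> * x\<close> turns the lower bound on left slopes
      into a sign condition, as \<open>L - \<gamma> < 0\<close>.\<close>
    have "((\<lambda>x. K x - \<gamma> * x) has_real_derivative L - \<gamma>) (at (1/2))"
      by (auto intro!: derivative_eq_intros D)
    then obtain d where d: "d > 0" "\<And>h. 0 < h \<Longrightarrow> h < d \<Longrightarrow> K (1/2) - \<gamma> * (1/2) < K (1/2 - h) - \<gamma> * (1/2 - h)"
      using DERIV_neg_dec_left[of "\<lambda>x. K x - \<gamma> * x" "L - \<gamma>" "1/2"] False \<gamma> by auto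
    define h where "h = min d (1/2) / 2"
    have "0 < h" "h < d" "h < 1/2" using d(1) by (auto simp: h_def min_def)
    then show False using d(2)[of h] left[of h] by (simp add: algebra_simps)
  qed
qed

text \<open>Reads the formula for \<open>u2\<close> backwards: \<open>K\<close> is p times the power
  p - 1 of \<open>- u2 x * deriv G (g x)\<close>, whose positivity inside the interval makes the
  power differentiable.\<close>

lemma K_derivative_if_C3:
  assumes C3: "C3_open u" and x: "x \<in> {0<..<1}"
  shows "\<exists>L. (K has_real_derivative L) (at x)"
proof -
  obtain v1 v2 v3 where v: "\<And>x. x \<in> {0<..<1} \<Longrightarrow> (u has_real_derivative v1 x) (at x)"
     "\<And>x. x \<in> {0<..<1} \<Longrightarrow> (v1 has_real_derivative v2 x) (at x)"
     "\<And>x. x \<in> {0<..<1} \<Longrightarrow> (v2 has_real_derivative v3 x) (at x)"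
    using C3 unfolding C3_open_def by blast
  have v1: "v1 y = g y" if "y \<in> {0<..<1}" for y
    using DERIV_imp_deriv[OF v(1)[OF that]] deriv_u[OF that] by simp
  have v2: "v2 y = u2 y" if y: "y \<in> {0<..<1}" for y
  proof -
    have "deriv g y = v2 y" by (rule deriv_eq_on_open[OF v(2)[OF y] y]) (simp add: v1)
    then show ?thesis using primitive_on_derivative_open[OF primitive_g_u2 cont_u2 y] by simp
  qed
  have dG: "((\<lambda>y. deriv G (g y)) has_real_derivative deriv (deriv G) (g x) * u2 x) (at x)"
    by (rule DERIV_chain2[OF standing_G_derivatives(1)[OF G]])
      (rule primitive_on_derivative[OF primitive_g_u2 cont_u2]; use x in simp)
  have "((\<lambda>y. - v2 y * deriv G (g y)) has_real_derivative
      - v2 x * (deriv (deriv G) (g x) * u2 x) + - v3 x * deriv G (g x)) (at x)"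
    using DERIV_mult[OF DERIV_minus[OF v(3)[OF x]] dG] by (simp add: algebra_simps)
  moreover have "0 < - v2 x * deriv G (g x)"
    using u2_neg[OF x] v2[OF x] G'_pos by (simp add: mult_neg_pos)
  ultimately have "\<exists>L. ((\<lambda>y. p * (- v2 y * deriv G (g y)) powr (p - 1)) has_real_derivative L) (at x)"
    by (intro exI) (rule DERIV_cmult, rule DERIV_fun_powr)
  then obtain L where L: "((\<lambda>y. p * (- v2 y * deriv G (g y)) powr (p - 1)) has_real_derivative L) (at x)" ..
  have "p * (- v2 y * deriv G (g y)) powr (p - 1) = K y" if y: "y \<in> {0<..<1}" for y
  proof -
    have "- v2 y * deriv G (g y) = (K y / p) powr \<alpha>"
      using v2[OF y] G'_pos[of "g y"] by (simp add: u2_def b_def)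
    then show ?thesis using K_pos[OF y] p by (simp add: powr_powr \<alpha>_def)
  qed
  then have "(K has_real_derivative L) (at x)"
    by (intro has_field_derivative_transform_within_open[OF L, of "{0<..<1}"]) (use x in auto)
  then show ?thesis ..
qed

lemma tent_not_C3:
  assumes tent: "\<And>x. \<psi> x = 1/4 - \<bar>x - 1/2\<bar>"
  shows "\<not> C3_open u"
proof
  assume "C3_open u"
  then obtain L where "(K has_real_derivative L) (at (1/2))" using K_derivative_if_C3[of "1/2"] by auto
  moreover have "\<not> (K has_real_derivative L) (at (1/2))"
    by (rule K_kink, rule tent_contact[OF tent])
  ultimately show False by blast
qed

end

lemma critical_obstacle_imp_critical_point:
  assumes G: "standing_G G" and p: "1 < p" and \<psi>: "standing_psi \<psi>" and u: "critical_obstacle G p \<psi> u"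
  obtains g v \<mu> where "critical_point G p \<psi> u g v \<mu>"
proof -
  obtain D where D: "sob_chain 2 u D" "\<And>j. j \<le> 2 \<Longrightarrow> Lp_on p (D j)"
    using u unfolding critical_obstacle_def M_set_def sobolev_def by auto
  have P: "primitive_on 0 1 (D 0) (D 1)" "primitive_on 0 1 (D 1) (D 2)"
    using D(1) by (auto simp: sob_chain_iff numeral_2_eq_2)
  have P0: "primitive_on 0 1 u (D 1)"
  proof (rule primitive_on_cong[OF P(1)])
    fix x :: real assume "0 \<le> x" "x \<le> 1"
    then show "u x = D 0 x" using D(1) by (simp add: sob_chain_iff)
  qed
  have ends: "u 0 = 0" "u 1 = 0" and above: "\<And>x. x \<in> {0..1} \<Longrightarrow> \<psi> x \<le> u x"
    using u by (simp_all add: critical_obstacle_def M_set_def W0_1p_def)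
  obtain \<mu> :: "real measure" where \<mu>: "sets \<mu> = sets (restrict_space borel {0..1})" "finite_measure \<mu>"
        "emeasure \<mu> ({0..1} - {x. u x = \<psi> x}) = 0"
        "\<And>\<phi>. sobolev 2 (Lp_on p) \<phi> \<Longrightarrow> W0_1p \<phi> \<Longrightarrow>
           - integral\<^sup>L (lebesgue_on {0..1})
               (\<lambda>x. euler_w G p u x * deriv (\<lambda>y. deriv G (deriv u y) * deriv \<phi> y) x)
           = integral\<^sup>L \<mu> \<phi>"
    using u unfolding critical_obstacle_def by blast
  have "critical_point G p \<psi> u (D 1) (D 2) \<mu>"
    by (intro critical_point.intro G p \<psi> P0 P(2) D(2) ends above \<mu>) simp_all
  then show ?thesis by (rule that)
qed

theorem theorem1p1:
  fixes G :: "real \<Rightarrow> real" and p :: real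
  assumes hG: "standing_G G" and hp: "1 < p"
  shows "(\<forall>\<psi> u. standing_psi \<psi> \<and> critical_obstacle G p \<psi> u \<longrightarrow>
            (\<exists>u1 u2. C2_closed_with u u1 u2 \<and> (\<forall>x\<in>{0<..<1}. u2 x < 0) \<and>
                      u2 0 = 0 \<and> u2 1 = 0) \<and>
            concave_on {0..1} u \<and>
            (p \<le> 2 \<longrightarrow> sobolev 3 Linf_on u \<and> third_deriv_BV u) \<and>
            (p > 2 \<longrightarrow> (\<forall>q. 1 \<le> q \<and> q < (p - 1) / (p - 2) \<longrightarrow> sobolev 3 (Lp_on q) u) \<and>
                       \<not> sobolev 3 (Lp_on ((p - 1) / (p - 2))) u))
       \<and> (p \<le> 2 \<longrightarrow> (\<exists>\<psi>. standing_psi \<psi> \<and>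
              (\<forall>u. critical_obstacle G p \<psi> u \<longrightarrow> \<not> C3_open u)))"
proof (intro conjI impI allI)
  fix \<psi> u assume h: "standing_psi \<psi> \<and> critical_obstacle G p \<psi> u"
  then obtain g v \<mu> where "critical_point G p \<psi> u g v \<mu>"
    using critical_obstacle_imp_critical_point[OF hG hp] by blast
  then interpret critical_point G p \<psi> u g v \<mu> .
  show "\<exists>u1 u2. C2_closed_with u u1 u2 \<and> (\<forall>x\<in>{0<..<1}. u2 x < 0) \<and> u2 0 = 0 \<and> u2 1 = 0"
    using C2 u2_neg u2_ends by blast
  show "concave_on {0..1} u" by (rule concave)
  show "sobolev 3 Linf_on u" "third_deriv_BV u" if "p \<le> 2"
    using W3_inf[OF that] W3_BV[OF that] by auto
  show "sobolev 3 (Lp_on q) u" if "p > 2" "1 \<le> q \<and> q < (p - 1) / (p - 2)" for q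
    using W3_q that by blast
  show "\<not> sobolev 3 (Lp_on ((p - 1) / (p - 2))) u" if "p > 2" by (rule not_W3_r[OF that])
next
  \<comment> \<open>One obstacle for all \<open>G\<close> and \<open>p\<close>: height 1/4 at the
    tip, -1/4 at the ends, with sides of slope 1 and -1.\<close>
  let ?\<psi> = "\<lambda>x::real. 1/4 - \<bar>x - 1/2\<bar>"
  have \<psi>: "standing_psi ?\<psi>"
    unfolding standing_psi_def by (auto intro!: continuous_intros bexI[of _ "1/2"])
  moreover have "\<not> C3_open u" if u: "critical_obstacle G p ?\<psi> u" for u
  proof -
    obtain g v \<mu> where "critical_point G p ?\<psi> u g v \<mu>"
      using critical_obstacle_imp_critical_point[OF hG hp \<psi> u] by blast
    then show ?thesis by (rule critical_point.tent_not_C3) simp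
  qed
  ultimately show "\<exists>\<psi>. standing_psi \<psi> \<and> (\<forall>u. critical_obstacle G p \<psi> u \<longrightarrow> \<not> C3_open u)" by blast
qed

end
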